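(* Let $R$ be a partition ring and let $\sum_{m\ge0}r_mt^m\in\mathrm{PD}(R)[[\Sigma]]$ be an exponential element (so $r_m\in\mathrm{PD}(R)(m)$). Then in $\mathrm{PD}(R)[[\Sigma]]$ we have the identity $$\sum_{m\ge0}r_mt^m=\exp\Big(\sum_{i\ge1}(r_i*\mathbf 1_i)\,t^i\Big),$$ where the exponential is interpreted integrally as explained in the context.
   Context: Partitions. A partition $\Lambda=(X,\sim_\Lambda)$ is a finite set $X$ with an equivalence relation; its classes are called blocks. A morphism $f\colon\Lambda\to\Omega=(Y,\sim_\Omega)$ is a bijection $f\colon X\to Y$ with $x\sim_\Lambda x'\Rightarrow f(x)\sim_\Omega f(x')$. There is a (unique) 2-isomorphism $f\Rightarrow g$ between morphisms $f,g\colon\Lambda\to\Omega$ exactly when $f(x)\sim_\Omega g(x)$ for all $x\in X$. This defines a $(2,1)$-category $\mathcal P$; a functor from $\mathcal P$ to an ordinary category identifies 2-isomorphic morphisms. Write $\Lambda\le\Omega$ (refinement) if $X=Y$ and the identity is a morphism $\Lambda\to\Omega$; $\Lambda<\Omega$ if moreover $\Lambda\ne\Omega$. $\Lambda\cap\Gamma$ is the coarsest common refinement; $\Lambda\sqcup\Omega$ is the disjoint union partition. $\underline m$ is $[m]=\{1,\dots,m\}$ with the indiscrete relation ($\underline 0$ is empty); likewise $\underline B$ for a finite set $B$. $\underline i\sqcup\underline j\le\underline{i+j}$ denotes the morphism sending $\underline i$ to the first $i$ and $\underline j$ to the last $j$ elements. $\Sigma_\Lambda$ is the group of bijections of $X$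 preserving every block. For a morphism $f\colon\Lambda\to\Omega$ and $\Gamma\le\Lambda$, $f\Gamma$ is the transported partition of $Y$ and $f_\Gamma\colon\Gamma\to f\Gamma$ the induced isomorphism. Partition rings. A partition functor $M$ consists of abelian groups $M(\Lambda)$, a contravariant functor $M^*$ (restrictions) and a covariant functor $M_*$ (transfers) from $\mathcal P$ to abelian groups with common values $M(\Lambda)$, with $M_*(f)=M^*(f^{-1})$ for isomorphisms $f$, and for $\Gamma,\Lambda\le\Omega$ $$M^*(\Gamma\le\Omega)M_*(\Lambda\le\Omega)=\sum_{[\sigma]\in\Sigma_\Gamma\backslash\Sigma_\Omega/\Sigma_\Lambda}M_*(\Gamma\cap\sigma\Lambda\le\Gamma)\,M_*(\sigma)\,M^*(\sigma^{-1}\Gamma\cap\Lambda\le\Lambda).$$ It is lax symmetric monoidal if equipped with a unit $\mathbb Z\to M(0)$ and external products $M(\Lambda)\otimes M(\Omega)\to M(\Lambda\sqcup\Omega)$, $x\otimes y\mapsto x\boxtimes y$, natural in pairs of restrictions and pairs of transfers, associative, unital, symmetric. A partition ring $R$ is a lax symmetric monoidal partition functor with each $R(\Lambda)$ a commutative ring (product written $*$), restrictions and external products ring maps, and $R_*(f)(R^*(f)(a)*b)=a*R_*(f)(b)$. Write $R(m)=R(\underline m)$. $\mathrm{PD}$. $I_\Gamma\subseteq R(\Gamma)$ is the sum of images of $R_*(\Omega<\Gamma)$ over $\Omega<\Gamma$; $\bar R(\Gamma)=R(\Gamma)/I_\Gamma$; for isomorphisms $f$, $\bar R_*(f)$ is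 induced by $R_*(f)$; external products descend to $\bar R$. $\mathrm{PD}(R)(\Lambda)=(\bigoplus_{\Gamma\le\Lambda}\bar R(\Gamma))^{\Sigma_\Lambda}$ with action $(\sigma x)_\Gamma=\bar R_*(\sigma)(x_{\sigma^{-1}\Gamma})$. It is a partition ring with componentwise product $*$, restriction $(\mathrm{PD}(R)^*(f)x)_\Gamma=\bar R_*(f_\Gamma)^{-1}(x_{f\Gamma})$, transfer along $f\colon\Psi\to\Lambda$ given by $(\mathrm{PD}(R)_*(f)x)_\Gamma=\sum\bar R_*(\sigma f)(x_{(\sigma f)^{-1}\Gamma})$, the sum over $[\sigma]\in\Sigma_\Gamma\backslash\Sigma_\Lambda/\Sigma_{f\Psi}$ with $\Gamma\le\sigma f\Psi$, and external product $(x\boxtimes y)_{\Gamma\sqcup\Theta}=x_\Gamma\boxtimes y_\Theta$. The ring $\bar R(m)=\bar R(\underline m)$ is a direct summand of $\mathrm{PD}(R)(m)$ (component $\Gamma=\underline m$), and $\mathbf 1_m\in\mathrm{PD}(R)(m)$ is the multiplicative identity of this summand extended by zero; so $r_i*\mathbf 1_i$ lies in the summand $\bar R(i)$. Rings of symmetric functions. For lax symmetric monoidal $M$, $M[[\Sigma]]=\prod_{m\ge0}M(m)$ is the commutative ring with the transfer product: for $x\in M(i)$, $y\in M(j)$, $xy=M_*(\underline i\sqcup\underline j\le\underline{i+j})(x\boxtimes y)$. Elements are written $\sum_m r_mt^m$ with $r_m\in M(m)$. The element is exponential if $r_0=1$ and $M^*(\underline i\sqcup\underline j\le\underline{i+j})(r_{i+j})=r_i\boxtimes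 r_j$ for all $i,j\ge0$. Integral exponential. For $x_i\in\bar R(i)\subseteq\mathrm{PD}(R)(i)$, $i\ge1$, the coefficient of $t^m$ in $\exp(\sum_ix_it^i)$ is $\sum_{\lambda}\frac1{\lambda!}\prod_ix_i^{\lambda_i}$, the sum over sequences $\lambda=(\lambda_1,\lambda_2,\dots)$ of natural numbers with $\sum_i i\lambda_i=m$, $\lambda!=\prod_i\lambda_i!$, powers in the transfer product. The transfer product $\prod_ix_i^{\lambda_i}$ is canonically $\lambda!$ times the element of $\mathrm{PD}(R)(m)$ whose $\Gamma$-component is the external product $\boxtimes_Bx_{|B|}\in\bar R(\Gamma)$ over the blocks $B$ of $\Gamma$ (each $x_{|B|}$ transported to $\bar R(\underline B)$ along any bijection) if $\Gamma$ has exactly $\lambda_i$ blocks of size $i$ for all $i$, and $0$ otherwise; $\frac1{\lambda!}\prod_ix_i^{\lambda_i}$ denotes this element. *)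

theory Defs
  imports "HOL-Algebra.QuotRing" "HOL-Combinatorics.Permutations" "HOL-Library.Nat_Bijection"
begin

section \<open>Partitions\<close>

text \<open>
  The points of a partition are natural numbers.  Up to isomorphism this is no restriction: every
  finite set is in bijection with a finite subset of the naturals.  The disjoint union has to live
  in the same universe and is therefore re-encoded by \<^const>\<open>sum_encode\<close>, i.e. the left summand
  goes to the even numbers and the right one to the odd numbers.
\<close>

type_synonym part = "nat set \<times> nat rel"

abbreviation pset :: "part \<Rightarrow> nat set" where "pset \<equiv> fst"
abbreviation prel :: "part \<Rightarrow> nat rel" where "prel \<equiv> snd"

definition is_partition :: "part \<Rightarrow> bool" where
  "is_partition \<Lambda> \<longleftrightarrow> finite (pset \<Lambda>) \<and> equiv (pset \<Lambda>) (prel \<Lambda>)"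

definition blocks :: "part \<Rightarrow> nat set set" where
  "blocks \<Lambda> = pset \<Lambda> // prel \<Lambda>"

text \<open>
  Only the values of a morphism on the underlying set of its source matter; the 2-isomorphism
  axioms of partition functors below make them insensitive to the other values.
\<close>

definition pmor :: "part \<Rightarrow> part \<Rightarrow> (nat \<Rightarrow> nat) \<Rightarrow> bool" where
  "pmor \<Lambda> \<Omega> f \<longleftrightarrow> is_partition \<Lambda> \<and> is_partition \<Omega> \<and> bij_betw f (pset \<Lambda>) (pset \<Omega>) \<and>
     (\<forall>x x'. (x, x') \<in> prel \<Lambda> \<longrightarrow> (f x, f x') \<in> prel \<Omega>)"

definition piso :: "part \<Rightarrow> part \<Rightarrow> (nat \<Rightarrow> nat) \<Rightarrow> bool" where
  "piso \<Lambda> \<Omega> f \<longleftrightarrow> pmor \<Lambda> \<Omega> f \<and> pmor \<Omega> \<Lambda> (inv_into (pset \<Lambda>) f)"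

definition two_iso :: "part \<Rightarrow> part \<Rightarrow> (nat \<Rightarrow> nat) \<Rightarrow> (nat \<Rightarrow> nat) \<Rightarrow> bool" where
  "two_iso \<Lambda> \<Omega> f g \<longleftrightarrow> pmor \<Lambda> \<Omega> f \<and> pmor \<Lambda> \<Omega> g \<and> (\<forall>x\<in>pset \<Lambda>. (f x, g x) \<in> prel \<Omega>)"

definition ple :: "part \<Rightarrow> part \<Rightarrow> bool" where
  "ple \<Lambda> \<Omega> \<longleftrightarrow> pset \<Lambda> = pset \<Omega> \<and> pmor \<Lambda> \<Omega> id"

definition pless :: "part \<Rightarrow> part \<Rightarrow> bool" where
  "pless \<Lambda> \<Omega> \<longleftrightarrow> ple \<Lambda> \<Omega> \<and> \<Lambda> \<noteq> \<Omega>"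

definition refinements :: "part \<Rightarrow> part set" where
  "refinements \<Lambda> = {\<Gamma>. ple \<Gamma> \<Lambda>}"

definition pmeet :: "part \<Rightarrow> part \<Rightarrow> part" where
  "pmeet \<Lambda> \<Gamma> = (pset \<Lambda> \<inter> pset \<Gamma>, prel \<Lambda> \<inter> prel \<Gamma>)"

definition ptransport :: "(nat \<Rightarrow> nat) \<Rightarrow> part \<Rightarrow> part" where
  "ptransport f \<Gamma> = (f ` pset \<Gamma>, map_prod f f ` prel \<Gamma>)"

definition indiscrete :: "nat set \<Rightarrow> part" where
  "indiscrete B = (B, B \<times> B)"

definition ul :: "nat \<Rightarrow> part" where
  "ul m = indiscrete {1..m}"

definition block_group :: "part \<Rightarrow> (nat \<Rightarrow> nat) set" where
  "block_group \<Lambda> = {\<sigma>. \<sigma> permutes pset \<Lambda> \<and> (\<forall>B\<in>blocks \<Lambda>. \<sigma> ` B = B)}"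

text \<open>The double cosets of \<open>block_group \<Omega>\<close> with respect to the subgroups of \<open>\<Gamma>\<close> (left) and \<open>\<Lambda>\<close> (right).\<close>

definition double_cosets :: "part \<Rightarrow> part \<Rightarrow> part \<Rightarrow> (nat \<Rightarrow> nat) set set" where
  "double_cosets \<Gamma> \<Omega> \<Lambda> =
     (\<lambda>\<sigma>. {\<gamma> \<circ> \<sigma> \<circ> \<tau> |\<gamma> \<tau>. \<gamma> \<in> block_group \<Gamma> \<and> \<tau> \<in> block_group \<Lambda>}) ` block_group \<Omega>"

definition rep :: "(nat \<Rightarrow> nat) set \<Rightarrow> nat \<Rightarrow> nat" where
  "rep D = (SOME \<sigma>. \<sigma> \<in> D)"


subsection \<open>The symmetric monoidal structure\<close>

abbreviation inl :: "nat \<Rightarrow> nat" where "inl x \<equiv> sum_encode (Inl x)"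
abbreviation inr :: "nat \<Rightarrow> nat" where "inr x \<equiv> sum_encode (Inr x)"

definition copair :: "(nat \<Rightarrow> nat) \<Rightarrow> (nat \<Rightarrow> nat) \<Rightarrow> nat \<Rightarrow> nat" where
  "copair f g n = case_sum f g (sum_decode n)"

definition psum :: "part \<Rightarrow> part \<Rightarrow> part" where
  "psum \<Lambda> \<Omega> = (inl ` pset \<Lambda> \<union> inr ` pset \<Omega>,
               map_prod inl inl ` prel \<Lambda> \<union> map_prod inr inr ` prel \<Omega>)"

definition sum_map :: "(nat \<Rightarrow> nat) \<Rightarrow> (nat \<Rightarrow> nat) \<Rightarrow> nat \<Rightarrow> nat" where
  "sum_map f g = copair (inl \<circ> f) (inr \<circ> g)"

definition sum_assoc :: "nat \<Rightarrow> nat" where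
  "sum_assoc = copair (copair inl (inr \<circ> inl)) (inr \<circ> inr)"

definition sum_swap :: "nat \<Rightarrow> nat" where
  "sum_swap = copair inr inl"

text \<open>The morphism from \<open>psum (ul i) (ul j)\<close> to \<open>ul (i + j)\<close>.\<close>

definition juxtapose :: "nat \<Rightarrow> nat \<Rightarrow> nat" where
  "juxtapose i = copair id (\<lambda>b. i + b)"

definition left_part :: "part \<Rightarrow> part" where
  "left_part \<Delta> = (inl -` pset \<Delta>, map_prod inl inl -` prel \<Delta>)"

definition right_part :: "part \<Rightarrow> part" where
  "right_part \<Delta> = (inr -` pset \<Delta>, map_prod inr inr -` prel \<Delta>)"


section \<open>Partition functors and partition rings\<close>

text \<open>
  For a morphism \<open>f\<close> from \<open>\<Lambda>\<close> to \<open>\<Omega>\<close>, \<open>Res M \<Lambda> \<Omega> f\<close> is the restriction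
  from \<open>Val M \<Omega>\<close> to \<open>Val M \<Lambda>\<close> and \<open>Tr M \<Lambda> \<Omega> f\<close> is the transfer in the other
  direction.  For mere partition functors only the additive part of the ring record \<open>Val M \<Lambda>\<close> is
  used.  \<open>Unt M\<close> is the image of 1 under the monoidal unit map from the integers to
  \<open>Val M (ul 0)\<close>.
\<close>

record 'r pfunctor =
  Val :: "part \<Rightarrow> 'r ring"
  Res :: "part \<Rightarrow> part \<Rightarrow> (nat \<Rightarrow> nat) \<Rightarrow> 'r \<Rightarrow> 'r"
  Tr :: "part \<Rightarrow> part \<Rightarrow> (nat \<Rightarrow> nat) \<Rightarrow> 'r \<Rightarrow> 'r"

record 'r monoidal_pfunctor = "'r pfunctor" +
  Ext :: "part \<Rightarrow> part \<Rightarrow> 'r \<Rightarrow> 'r \<Rightarrow> 'r"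
  Unt :: 'r

text \<open>
  In the double coset formula the summand does not depend on the chosen representative: elements of
  \<open>block_group \<Gamma>\<close> are 2-isomorphic to the identity of \<open>\<Gamma>\<close>.
\<close>

locale partition_functor =
  fixes M :: "('r, 'z) pfunctor_scheme"
  assumes abelian: "is_partition \<Lambda> \<Longrightarrow> abelian_group (Val M \<Lambda>)"
    and Res_hom: "pmor \<Lambda> \<Omega> f \<Longrightarrow>
      Res M \<Lambda> \<Omega> f \<in> hom (add_monoid (Val M \<Omega>)) (add_monoid (Val M \<Lambda>))"
    and Tr_hom: "pmor \<Lambda> \<Omega> f \<Longrightarrow>
      Tr M \<Lambda> \<Omega> f \<in> hom (add_monoid (Val M \<Lambda>)) (add_monoid (Val M \<Omega>))"
    and Res_id: "\<lbrakk>is_partition \<Lambda>; a \<in> carrier (Val M \<Lambda>)\<rbrakk> \<Longrightarrow> Res M \<Lambda> \<Lambda> id a = a"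
    and Tr_id: "\<lbrakk>is_partition \<Lambda>; a \<in> carrier (Val M \<Lambda>)\<rbrakk> \<Longrightarrow> Tr M \<Lambda> \<Lambda> id a = a"
    and Res_comp: "\<lbrakk>pmor \<Lambda> \<Omega> f; pmor \<Omega> \<Psi> g; a \<in> carrier (Val M \<Psi>)\<rbrakk> \<Longrightarrow>
      Res M \<Lambda> \<Psi> (g \<circ> f) a = Res M \<Lambda> \<Omega> f (Res M \<Omega> \<Psi> g a)"
    and Tr_comp: "\<lbrakk>pmor \<Lambda> \<Omega> f; pmor \<Omega> \<Psi> g; a \<in> carrier (Val M \<Lambda>)\<rbrakk> \<Longrightarrow>
      Tr M \<Lambda> \<Psi> (g \<circ> f) a = Tr M \<Omega> \<Psi> g (Tr M \<Lambda> \<Omega> f a)"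
    and Res_two_iso: "\<lbrakk>two_iso \<Lambda> \<Omega> f g; a \<in> carrier (Val M \<Omega>)\<rbrakk> \<Longrightarrow>
      Res M \<Lambda> \<Omega> f a = Res M \<Lambda> \<Omega> g a"
    and Tr_two_iso: "\<lbrakk>two_iso \<Lambda> \<Omega> f g; a \<in> carrier (Val M \<Lambda>)\<rbrakk> \<Longrightarrow>
      Tr M \<Lambda> \<Omega> f a = Tr M \<Lambda> \<Omega> g a"
    and Tr_iso: "\<lbrakk>piso \<Lambda> \<Omega> f; a \<in> carrier (Val M \<Lambda>)\<rbrakk> \<Longrightarrow>
      Tr M \<Lambda> \<Omega> f a = Res M \<Omega> \<Lambda> (inv_into (pset \<Lambda>) f) a"
    and double_coset_formula: "\<lbrakk>ple \<Gamma> \<Omega>; ple \<Lambda> \<Omega>; a \<in> carrier (Val M \<Lambda>)\<rbrakk> \<Longrightarrow>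
      Res M \<Gamma> \<Omega> id (Tr M \<Lambda> \<Omega> id a) =
        (\<Oplus>\<^bsub>Val M \<Gamma>\<^esub>D\<in>double_cosets \<Gamma> \<Omega> \<Lambda>.
          let \<sigma> = rep D;
              \<Delta> = pmeet \<Gamma> (ptransport \<sigma> \<Lambda>);
              \<Delta>' = pmeet (ptransport (inv_into UNIV \<sigma>) \<Gamma>) \<Lambda>
          in Tr M \<Delta> \<Gamma> id (Tr M \<Delta>' \<Delta> \<sigma> (Res M \<Delta>' \<Lambda> id a)))"

locale monoidal_partition_functor = partition_functor M
  for M :: "('r, 'z) monoidal_pfunctor_scheme" +
  assumes Unt_closed: "Unt M \<in> carrier (Val M (ul 0))"
    and Ext_closed: "\<lbrakk>is_partition \<Lambda>; is_partition \<Omega>;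
        x \<in> carrier (Val M \<Lambda>); y \<in> carrier (Val M \<Omega>)\<rbrakk> \<Longrightarrow>
      Ext M \<Lambda> \<Omega> x y \<in> carrier (Val M (psum \<Lambda> \<Omega>))"
    and Ext_add_left: "\<lbrakk>is_partition \<Lambda>; is_partition \<Omega>;
        x \<in> carrier (Val M \<Lambda>); x' \<in> carrier (Val M \<Lambda>); y \<in> carrier (Val M \<Omega>)\<rbrakk> \<Longrightarrow>
      Ext M \<Lambda> \<Omega> (x \<oplus>\<^bsub>Val M \<Lambda>\<^esub> x') y =
        Ext M \<Lambda> \<Omega> x y \<oplus>\<^bsub>Val M (psum \<Lambda> \<Omega>)\<^esub> Ext M \<Lambda> \<Omega> x' y"
    and Ext_add_right: "\<lbrakk>is_partition \<Lambda>; is_partition \<Omega>;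
        x \<in> carrier (Val M \<Lambda>); y \<in> carrier (Val M \<Omega>); y' \<in> carrier (Val M \<Omega>)\<rbrakk> \<Longrightarrow>
      Ext M \<Lambda> \<Omega> x (y \<oplus>\<^bsub>Val M \<Omega>\<^esub> y') =
        Ext M \<Lambda> \<Omega> x y \<oplus>\<^bsub>Val M (psum \<Lambda> \<Omega>)\<^esub> Ext M \<Lambda> \<Omega> x y'"
    and Ext_Res: "\<lbrakk>pmor \<Lambda> \<Lambda>' f; pmor \<Omega> \<Omega>' g;
        x \<in> carrier (Val M \<Lambda>'); y \<in> carrier (Val M \<Omega>')\<rbrakk> \<Longrightarrow>
      Res M (psum \<Lambda> \<Omega>) (psum \<Lambda>' \<Omega>') (sum_map f g) (Ext M \<Lambda>' \<Omega>' x y) =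
        Ext M \<Lambda> \<Omega> (Res M \<Lambda> \<Lambda>' f x) (Res M \<Omega> \<Omega>' g y)"
    and Ext_Tr: "\<lbrakk>pmor \<Lambda> \<Lambda>' f; pmor \<Omega> \<Omega>' g;
        x \<in> carrier (Val M \<Lambda>); y \<in> carrier (Val M \<Omega>)\<rbrakk> \<Longrightarrow>
      Tr M (psum \<Lambda> \<Omega>) (psum \<Lambda>' \<Omega>') (sum_map f g) (Ext M \<Lambda> \<Omega> x y) =
        Ext M \<Lambda>' \<Omega>' (Tr M \<Lambda> \<Lambda>' f x) (Tr M \<Omega> \<Omega>' g y)"
    and Ext_assoc: "\<lbrakk>is_partition \<Lambda>; is_partition \<Omega>; is_partition \<Psi>;
        x \<in> carrier (Val M \<Lambda>); y \<in> carrier (Val M \<Omega>); z \<in> carrier (Val M \<Psi>)\<rbrakk> \<Longrightarrow>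
      Tr M (psum (psum \<Lambda> \<Omega>) \<Psi>) (psum \<Lambda> (psum \<Omega> \<Psi>)) sum_assoc
        (Ext M (psum \<Lambda> \<Omega>) \<Psi> (Ext M \<Lambda> \<Omega> x y) z) =
        Ext M \<Lambda> (psum \<Omega> \<Psi>) x (Ext M \<Omega> \<Psi> y z)"
    and Ext_unit_left: "\<lbrakk>is_partition \<Lambda>; x \<in> carrier (Val M \<Lambda>)\<rbrakk> \<Longrightarrow>
      Tr M (psum (ul 0) \<Lambda>) \<Lambda> (copair id id) (Ext M (ul 0) \<Lambda> (Unt M) x) = x"
    and Ext_unit_right: "\<lbrakk>is_partition \<Lambda>; x \<in> carrier (Val M \<Lambda>)\<rbrakk> \<Longrightarrow>
      Tr M (psum \<Lambda> (ul 0)) \<Lambda> (copair id id) (Ext M \<Lambda> (ul 0) x (Unt M)) = x"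
    and Ext_sym: "\<lbrakk>is_partition \<Lambda>; is_partition \<Omega>;
        x \<in> carrier (Val M \<Lambda>); y \<in> carrier (Val M \<Omega>)\<rbrakk> \<Longrightarrow>
      Tr M (psum \<Lambda> \<Omega>) (psum \<Omega> \<Lambda>) sum_swap (Ext M \<Lambda> \<Omega> x y) = Ext M \<Omega> \<Lambda> y x"

locale partition_ring = monoidal_partition_functor R
  for R :: "('r, 'z) monoidal_pfunctor_scheme" +
  assumes cring: "is_partition \<Lambda> \<Longrightarrow> cring (Val R \<Lambda>)"
    and Res_ring_hom: "pmor \<Lambda> \<Omega> f \<Longrightarrow> Res R \<Lambda> \<Omega> f \<in> ring_hom (Val R \<Omega>) (Val R \<Lambda>)"
    and Ext_mult: "\<lbrakk>is_partition \<Lambda>; is_partition \<Omega>;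
        x \<in> carrier (Val R \<Lambda>); x' \<in> carrier (Val R \<Lambda>);
        y \<in> carrier (Val R \<Omega>); y' \<in> carrier (Val R \<Omega>)\<rbrakk> \<Longrightarrow>
      Ext R \<Lambda> \<Omega> (x \<otimes>\<^bsub>Val R \<Lambda>\<^esub> x') (y \<otimes>\<^bsub>Val R \<Omega>\<^esub> y') =
        Ext R \<Lambda> \<Omega> x y \<otimes>\<^bsub>Val R (psum \<Lambda> \<Omega>)\<^esub> Ext R \<Lambda> \<Omega> x' y'"
    and Ext_one: "\<lbrakk>is_partition \<Lambda>; is_partition \<Omega>\<rbrakk> \<Longrightarrow>
      Ext R \<Lambda> \<Omega> \<one>\<^bsub>Val R \<Lambda>\<^esub> \<one>\<^bsub>Val R \<Omega>\<^esub> = \<one>\<^bsub>Val R (psum \<Lambda> \<Omega>)\<^esub>"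
    and Frobenius: "\<lbrakk>pmor \<Lambda> \<Omega> f; a \<in> carrier (Val R \<Omega>); b \<in> carrier (Val R \<Lambda>)\<rbrakk> \<Longrightarrow>
      Tr R \<Lambda> \<Omega> f (Res R \<Lambda> \<Omega> f a \<otimes>\<^bsub>Val R \<Lambda>\<^esub> b) =
        a \<otimes>\<^bsub>Val R \<Omega>\<^esub> Tr R \<Lambda> \<Omega> f b"


section \<open>Symmetric functions\<close>

definition sym_series :: "('r, 'z) monoidal_pfunctor_scheme \<Rightarrow> (nat \<Rightarrow> 'r) ring" where
  "sym_series M = \<lparr>
     carrier = {r. \<forall>m. r m \<in> carrier (Val M (ul m))},
     monoid.mult = (\<lambda>r s m. \<Oplus>\<^bsub>Val M (ul m)\<^esub>i\<in>{..m}.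
       Tr M (psum (ul i) (ul (m - i))) (ul m) (juxtapose i)
         (Ext M (ul i) (ul (m - i)) (r i) (s (m - i)))),
     one = (\<lambda>m. if m = 0 then Unt M else \<zero>\<^bsub>Val M (ul m)\<^esub>),
     zero = (\<lambda>m. \<zero>\<^bsub>Val M (ul m)\<^esub>),
     add = (\<lambda>r s m. r m \<oplus>\<^bsub>Val M (ul m)\<^esub> s m)\<rparr>"

definition exponential :: "('r, 'z) monoidal_pfunctor_scheme \<Rightarrow> (nat \<Rightarrow> 'r) \<Rightarrow> bool" where
  "exponential M r \<longleftrightarrow> r 0 = Unt M \<and>
     (\<forall>i j. Res M (psum (ul i) (ul j)) (ul (i + j)) (juxtapose i) (r (i + j)) =
            Ext M (ul i) (ul j) (r i) (r j))"


section \<open>The partition ring PD\<close>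

definition Tr_ideal :: "('r, 'z) monoidal_pfunctor_scheme \<Rightarrow> part \<Rightarrow> 'r set" where
  "Tr_ideal R \<Gamma> = {\<Oplus>\<^bsub>Val R \<Gamma>\<^esub>\<Omega>\<in>{\<Omega>. pless \<Omega> \<Gamma>}. Tr R \<Omega> \<Gamma> id (c \<Omega>) |c.
     \<forall>\<Omega>. pless \<Omega> \<Gamma> \<longrightarrow> c \<Omega> \<in> carrier (Val R \<Omega>)}"

definition Bar :: "('r, 'z) monoidal_pfunctor_scheme \<Rightarrow> part \<Rightarrow> 'r set ring" where
  "Bar R \<Gamma> = Val R \<Gamma> Quot Tr_ideal R \<Gamma>"

definition Bar_class :: "('r, 'z) monoidal_pfunctor_scheme \<Rightarrow> part \<Rightarrow> 'r \<Rightarrow> 'r set" where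
  "Bar_class R \<Gamma> a = Tr_ideal R \<Gamma> +>\<^bsub>Val R \<Gamma>\<^esub> a"

text \<open>
  The maps induced on quotients, in the style of \<^const>\<open>rcoset_mult\<close>: the union over all
  representatives is a single coset whenever the induced map is well defined.
\<close>

definition Bar_Tr :: "('r, 'z) monoidal_pfunctor_scheme \<Rightarrow>
    part \<Rightarrow> part \<Rightarrow> (nat \<Rightarrow> nat) \<Rightarrow> 'r set \<Rightarrow> 'r set" where
  "Bar_Tr R \<Gamma> \<Gamma>' f A = (\<Union>a\<in>A. Bar_class R \<Gamma>' (Tr R \<Gamma> \<Gamma>' f a))"

definition Bar_Ext :: "('r, 'z) monoidal_pfunctor_scheme \<Rightarrow>
    part \<Rightarrow> part \<Rightarrow> 'r set \<Rightarrow> 'r set \<Rightarrow> 'r set" where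
  "Bar_Ext R \<Gamma> \<Theta> A B = (\<Union>a\<in>A. \<Union>b\<in>B. Bar_class R (psum \<Gamma> \<Theta>) (Ext R \<Gamma> \<Theta> a b))"

definition PD_act :: "('r, 'z) monoidal_pfunctor_scheme \<Rightarrow> part \<Rightarrow>
    (nat \<Rightarrow> nat) \<Rightarrow> (part \<Rightarrow> 'r set) \<Rightarrow> part \<Rightarrow> 'r set" where
  "PD_act R \<Lambda> \<sigma> x = (\<lambda>\<Gamma>\<in>refinements \<Lambda>.
     Bar_Tr R (ptransport (inv_into UNIV \<sigma>) \<Gamma>) \<Gamma> \<sigma> (x (ptransport (inv_into UNIV \<sigma>) \<Gamma>)))"

definition PD_ring :: "('r, 'z) monoidal_pfunctor_scheme \<Rightarrow> part \<Rightarrow> (part \<Rightarrow> 'r set) ring" where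
  "PD_ring R \<Lambda> = \<lparr>
     carrier = {x \<in> (\<Pi>\<^sub>E \<Gamma>\<in>refinements \<Lambda>. carrier (Bar R \<Gamma>)).
                 \<forall>\<sigma>\<in>block_group \<Lambda>. PD_act R \<Lambda> \<sigma> x = x},
     monoid.mult = (\<lambda>x y. \<lambda>\<Gamma>\<in>refinements \<Lambda>. x \<Gamma> \<otimes>\<^bsub>Bar R \<Gamma>\<^esub> y \<Gamma>),
     one = (\<lambda>\<Gamma>\<in>refinements \<Lambda>. \<one>\<^bsub>Bar R \<Gamma>\<^esub>),
     zero = (\<lambda>\<Gamma>\<in>refinements \<Lambda>. \<zero>\<^bsub>Bar R \<Gamma>\<^esub>),
     add = (\<lambda>x y. \<lambda>\<Gamma>\<in>refinements \<Lambda>. x \<Gamma> \<oplus>\<^bsub>Bar R \<Gamma>\<^esub> y \<Gamma>)\<rparr>"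

definition PD_Res :: "('r, 'z) monoidal_pfunctor_scheme \<Rightarrow> part \<Rightarrow> part \<Rightarrow> (nat \<Rightarrow> nat) \<Rightarrow>
    (part \<Rightarrow> 'r set) \<Rightarrow> part \<Rightarrow> 'r set" where
  "PD_Res R \<Lambda> \<Omega> f x = (\<lambda>\<Gamma>\<in>refinements \<Lambda>.
     inv_into (carrier (Bar R \<Gamma>)) (Bar_Tr R \<Gamma> (ptransport f \<Gamma>) f) (x (ptransport f \<Gamma>)))"

text \<open>
  Neither the condition on the double coset nor the summand depends on the representative, by
  invariance of \<open>x\<close> under \<open>block_group \<Psi>\<close>.
\<close>

definition PD_Tr :: "('r, 'z) monoidal_pfunctor_scheme \<Rightarrow> part \<Rightarrow> part \<Rightarrow> (nat \<Rightarrow> nat) \<Rightarrow>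
    (part \<Rightarrow> 'r set) \<Rightarrow> part \<Rightarrow> 'r set" where
  "PD_Tr R \<Psi> \<Lambda> f x = (\<lambda>\<Gamma>\<in>refinements \<Lambda>.
     \<Oplus>\<^bsub>Bar R \<Gamma>\<^esub>D\<in>{D \<in> double_cosets \<Gamma> \<Lambda> (ptransport f \<Psi>).
                     ple \<Gamma> (ptransport (rep D \<circ> f) \<Psi>)}.
       let g = rep D \<circ> f; \<Gamma>' = ptransport (inv_into (pset \<Psi>) g) \<Gamma>
       in Bar_Tr R \<Gamma>' \<Gamma> g (x \<Gamma>'))"

text \<open>
  Every refinement of \<open>psum \<Lambda> \<Omega>\<close> is \<open>psum \<Gamma> \<Theta>\<close> for unique refinements \<open>\<Gamma>\<close> of
  \<open>\<Lambda>\<close> and \<open>\<Theta>\<close> of \<open>\<Omega>\<close>, namely its left and its right part.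
\<close>

definition PD_Ext :: "('r, 'z) monoidal_pfunctor_scheme \<Rightarrow> part \<Rightarrow> part \<Rightarrow>
    (part \<Rightarrow> 'r set) \<Rightarrow> (part \<Rightarrow> 'r set) \<Rightarrow> part \<Rightarrow> 'r set" where
  "PD_Ext R \<Lambda> \<Omega> x y = (\<lambda>\<Delta>\<in>refinements (psum \<Lambda> \<Omega>).
     Bar_Ext R (left_part \<Delta>) (right_part \<Delta>) (x (left_part \<Delta>)) (y (right_part \<Delta>)))"

definition PD :: "('r, 'z) monoidal_pfunctor_scheme \<Rightarrow> (part \<Rightarrow> 'r set) monoidal_pfunctor" where
  "PD R = \<lparr>
     Val = PD_ring R,
     Res = PD_Res R,
     Tr = PD_Tr R,
     Ext = PD_Ext R,
     Unt = (\<lambda>\<Gamma>\<in>refinements (ul 0). Bar_class R \<Gamma> (Unt R))\<rparr>"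

definition top_one :: "('r, 'z) monoidal_pfunctor_scheme \<Rightarrow> nat \<Rightarrow> part \<Rightarrow> 'r set" where
  "top_one R m = (\<lambda>\<Gamma>\<in>refinements (ul m).
     if \<Gamma> = ul m then \<one>\<^bsub>Bar R \<Gamma>\<^esub> else \<zero>\<^bsub>Bar R \<Gamma>\<^esub>)"


section \<open>The integral exponential\<close>

text \<open>
  The external product of the \<open>x |B|\<close> over the blocks \<open>B\<close> of \<open>\<Gamma>\<close> is formed along a list of the
  blocks, as an element over an iterated disjoint union of indiscrete partitions, and then moved to
  \<open>\<Gamma>\<close> along the canonical isomorphism \<open>blocks_iso\<close>.  By symmetry and associativity it does not
  depend on the order of the list, and it does not depend on the bijections chosen in
  \<open>on_block\<close>, since any two of them are 2-isomorphic.
\<close>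

fun blocks_sum :: "nat set list \<Rightarrow> part" where
  "blocks_sum [] = ul 0"
| "blocks_sum (B # Bs) = psum (indiscrete B) (blocks_sum Bs)"

fun blocks_iso :: "nat set list \<Rightarrow> nat \<Rightarrow> nat" where
  "blocks_iso [] = id"
| "blocks_iso (B # Bs) = copair id (blocks_iso Bs)"

definition on_block :: "('r, 'z) monoidal_pfunctor_scheme \<Rightarrow> (nat \<Rightarrow> 'r set) \<Rightarrow> nat set \<Rightarrow> 'r set" where
  "on_block R x B = Bar_Tr R (ul (card B)) (indiscrete B)
     (SOME h. bij_betw h {1..card B} B) (x (card B))"

fun blocks_Ext :: "('r, 'z) monoidal_pfunctor_scheme \<Rightarrow> (nat \<Rightarrow> 'r set) \<Rightarrow> nat set list \<Rightarrow> 'r set" where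
  "blocks_Ext R x [] = Bar_class R (ul 0) (Unt R)"
| "blocks_Ext R x (B # Bs) =
     Bar_Ext R (indiscrete B) (blocks_sum Bs) (on_block R x B) (blocks_Ext R x Bs)"

definition block_product :: "('r, 'z) monoidal_pfunctor_scheme \<Rightarrow> (nat \<Rightarrow> 'r set) \<Rightarrow> part \<Rightarrow> 'r set" where
  "block_product R x \<Gamma> =
     (let Bs = (SOME Bs. distinct Bs \<and> set Bs = blocks \<Gamma>)
      in Bar_Tr R (blocks_sum Bs) \<Gamma> (blocks_iso Bs) (blocks_Ext R x Bs))"

text \<open>
  A sequence \<open>(l 1, l 2, ...)\<close> is a function on the naturals with \<open>l 0 = 0\<close>.
\<close>

definition exponents :: "nat \<Rightarrow> (nat \<Rightarrow> nat) set" where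
  "exponents m = {l. l 0 = 0 \<and> finite {i. l i \<noteq> 0} \<and> (\<Sum>i | l i \<noteq> 0. i * l i) = m}"

definition has_type :: "part \<Rightarrow> (nat \<Rightarrow> nat) \<Rightarrow> bool" where
  "has_type \<Gamma> l \<longleftrightarrow> (\<forall>i\<ge>1. card {B \<in> blocks \<Gamma>. card B = i} = l i)"

text \<open>
  The divided monomial (product of the \<open>x i ^ l i\<close>, divided by the product of the factorials of the
  \<open>l i\<close>) and the exponential, for a sequence \<open>x\<close> whose member \<open>x i\<close> in \<open>PD_ring R (ul i)\<close> lies in
  the summand \<open>Bar R (ul i)\<close>; the corresponding element of \<open>Bar R (ul i)\<close> is the component
  \<open>x i (ul i)\<close>.
\<close>

definition divided_monomial :: "('r, 'z) monoidal_pfunctor_scheme \<Rightarrow>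
    (nat \<Rightarrow> part \<Rightarrow> 'r set) \<Rightarrow> nat \<Rightarrow> (nat \<Rightarrow> nat) \<Rightarrow> part \<Rightarrow> 'r set" where
  "divided_monomial R x m l = (\<lambda>\<Gamma>\<in>refinements (ul m).
     if has_type \<Gamma> l then block_product R (\<lambda>i. x i (ul i)) \<Gamma> else \<zero>\<^bsub>Bar R \<Gamma>\<^esub>)"

definition integral_exp :: "('r, 'z) monoidal_pfunctor_scheme \<Rightarrow>
    (nat \<Rightarrow> part \<Rightarrow> 'r set) \<Rightarrow> nat \<Rightarrow> part \<Rightarrow> 'r set" where
  "integral_exp R x = (\<lambda>m. \<Oplus>\<^bsub>Val (PD R) (ul m)\<^esub>l\<in>exponents m. divided_monomial R x m l)"

end

theory Submission
  imports Defs
begin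

text \<open>
  Evaluated at a component, exponentiality says that \<open>r (i + j)\<close> takes on the juxtaposition of
  \<open>\<Gamma>\<close> and \<open>\<Theta>\<close> the value \<open>r i \<Gamma> \<boxtimes> r j \<Theta>\<close>.  Splitting off one block at a time, and using
  that \<open>r m\<close> is invariant under all permutations of \<open>{1..m}\<close> to move the blocks into place, the
  component of \<open>r m\<close> at \<open>\<Gamma>\<close> is the external product over the blocks \<open>B\<close> of \<open>\<Gamma>\<close> of the top
  components of \<open>r |B|\<close>.  Exactly one summand of the integral exponential is supported at \<open>\<Gamma>\<close>,
  the one for the block type of \<open>\<Gamma>\<close>, and it has the same value there.
\<close>

section \<open>Partitions and isomorphisms\<close>

text \<open>The induced maps on quotients are unions over representatives, restriction in
  \<open>PD R\<close> goes through \<open>inv_into\<close>, and the block product involves an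
  arbitrary list of blocks and arbitrary bijections. None of these can be computed until transfers
  along isomorphisms and external products are known to descend to the quotients, which is why the
  ideals of proper transfers are treated at length.

  The choice of the list is met by strengthening instead of by a separate proof that the order does
  not matter: the formula for the component is proved for every list of finite nonempty sets and
  every bijection from their formal disjoint union onto \<open>{1..m}\<close>, and the chosen list
  is one instance. Isomorphisms are treated as transports: the source and an injective map determine
  the target, so identities between partitions become computations with
  \<open>ptransport\<close>.\<close>

lemma partition_prel_in:
  "is_partition \<Gamma> \<Longrightarrow> (x, y) \<in> prel \<Gamma> \<Longrightarrow> x \<in> pset \<Gamma> \<and> y \<in> pset \<Gamma>"
  unfolding is_partition_def equiv_def refl_on_def by blast

text \<open>Maps are total on the naturals although only their values on the points matter; being a
  partition confines the related pairs to those points.\<close>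

lemma ptransport_cong:
  assumes "is_partition \<Gamma>" "\<And>x. x \<in> pset \<Gamma> \<Longrightarrow> f x = g x"
  shows "ptransport f \<Gamma> = ptransport g \<Gamma>"
proof -
  have "map_prod f f ` prel \<Gamma> = map_prod g g ` prel \<Gamma>"
    using assms partition_prel_in[OF assms(1)] by (intro image_cong) auto
  then show ?thesis
    using assms(2) by (simp add: ptransport_def cong: image_cong)
qed

lemma ptransport_comp: "ptransport (g \<circ> f) \<Gamma> = ptransport g (ptransport f \<Gamma>)"
  by (simp add: ptransport_def image_comp map_prod.comp)

lemma ptransport_id [simp]: "ptransport id \<Gamma> = \<Gamma>"
  by (simp add: ptransport_def map_prod.id)

lemma pset_ptransport [simp]: "pset (ptransport f \<Gamma>) = f ` pset \<Gamma>"
  by (simp add: ptransport_def)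

lemma prel_ptransport: "prel (ptransport f \<Gamma>) = map_prod f f ` prel \<Gamma>"
  by (simp add: ptransport_def)

lemma ptransport_inv_into:
  assumes "is_partition \<Gamma>" "inj_on f (pset \<Gamma>)"
  shows "ptransport (inv_into (pset \<Gamma>) f) (ptransport f \<Gamma>) = \<Gamma>"
  using ptransport_cong[OF assms(1), of "inv_into (pset \<Gamma>) f \<circ> f" id] assms(2)
  by (simp add: ptransport_comp)

lemma mem_prel_ptransport:
  assumes "is_partition \<Gamma>" "inj_on f (pset \<Gamma>)" "x \<in> pset \<Gamma>" "y \<in> pset \<Gamma>"
  shows "(f x, f y) \<in> prel (ptransport f \<Gamma>) \<longleftrightarrow> (x, y) \<in> prel \<Gamma>"
proof
  assume "(f x, f y) \<in> prel (ptransport f \<Gamma>)"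
  then obtain a b where ab: "(a, b) \<in> prel \<Gamma>" "f x = f a" "f y = f b"
    by (auto simp: prel_ptransport)
  then show "(x, y) \<in> prel \<Gamma>"
    using partition_prel_in[OF assms(1) ab(1)] assms(2-4) by (metis inj_onD)
qed (force simp: prel_ptransport)

lemma is_partition_ptransport:
  assumes "is_partition \<Gamma>" "inj_on f (pset \<Gamma>)"
  shows "is_partition (ptransport f \<Gamma>)"
proof -
  have eq: "equiv (pset \<Gamma>) (prel \<Gamma>)" "finite (pset \<Gamma>)"
    using assms(1) by (auto simp: is_partition_def)
  have sub: "prel (ptransport f \<Gamma>) \<subseteq> f ` pset \<Gamma> \<times> f ` pset \<Gamma>"
    using partition_prel_in[OF assms(1)] by (auto simp: prel_ptransport)
  have "equiv (f ` pset \<Gamma>) (prel (ptransport f \<Gamma>))"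
  proof (rule equivI)
    show "prel (ptransport f \<Gamma>) \<subseteq> f ` pset \<Gamma> \<times> f ` pset \<Gamma>" by (fact sub)
    show "refl_on (f ` pset \<Gamma>) (prel (ptransport f \<Gamma>))"
      using eq(1) mem_prel_ptransport[OF assms] by (auto simp: equiv_def refl_on_def)
    show "sym (prel (ptransport f \<Gamma>))"
      using eq(1) by (auto simp: equiv_def sym_def prel_ptransport)
    show "trans (prel (ptransport f \<Gamma>))"
    proof (rule transI)
      fix x y z
      assume xy: "(x, y) \<in> prel (ptransport f \<Gamma>)" and yz: "(y, z) \<in> prel (ptransport f \<Gamma>)"
      then obtain a b c where "a \<in> pset \<Gamma>" "b \<in> pset \<Gamma>" "c \<in> pset \<Gamma>" "x = f a" "y = f b" "z = f c"
        using sub by blast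
      then show "(x, z) \<in> prel (ptransport f \<Gamma>)"
        using xy yz mem_prel_ptransport[OF assms] eq(1) unfolding equiv_def
        by (metis transD)
    qed
  qed
  then show ?thesis using eq(2) by (simp add: is_partition_def)
qed

text \<open>Since the inverse is a morphism too, the target carries exactly the image relation and
  is forced to be the transport of the source. Rewriting with this reduces compositions and inverses
  of isomorphisms to facts about injective maps.\<close>

lemma piso_iff:
  "piso \<Gamma> \<Gamma>' f \<longleftrightarrow> is_partition \<Gamma> \<and> inj_on f (pset \<Gamma>) \<and> \<Gamma>' = ptransport f \<Gamma>"
proof
  assume iso: "piso \<Gamma> \<Gamma>' f"
  then have p: "is_partition \<Gamma>" "is_partition \<Gamma>'" and bij: "bij_betw f (pset \<Gamma>) (pset \<Gamma>')"
    and fwd: "\<And>x y. (x, y) \<in> prel \<Gamma> \<Longrightarrow> (f x, f y) \<in> prel \<Gamma>'"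
    and bwd: "\<And>x y. (x, y) \<in> prel \<Gamma>' \<Longrightarrow>
      (inv_into (pset \<Gamma>) f x, inv_into (pset \<Gamma>) f y) \<in> prel \<Gamma>"
    by (auto simp: piso_def pmor_def)
  have "prel \<Gamma>' = map_prod f f ` prel \<Gamma>"
  proof
    show "prel \<Gamma>' \<subseteq> map_prod f f ` prel \<Gamma>"
    proof (rule subrelI)
      fix x y assume xy: "(x, y) \<in> prel \<Gamma>'"
      then have "x \<in> f ` pset \<Gamma>" "y \<in> f ` pset \<Gamma>"
        using partition_prel_in[OF p(2) xy] bij by (auto simp: bij_betw_def)
      then show "(x, y) \<in> map_prod f f ` prel \<Gamma>"
        using bwd[OF xy] by (intro image_eqI[OF _ bwd[OF xy]]) (simp add: f_inv_into_f)
    qed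
  qed (use fwd in auto)
  then show "is_partition \<Gamma> \<and> inj_on f (pset \<Gamma>) \<and> \<Gamma>' = ptransport f \<Gamma>"
    using p bij by (auto simp: ptransport_def bij_betw_def prod_eq_iff)
next
  assume R: "is_partition \<Gamma> \<and> inj_on f (pset \<Gamma>) \<and> \<Gamma>' = ptransport f \<Gamma>"
  then have p: "is_partition \<Gamma>" and inj: "inj_on f (pset \<Gamma>)" and eq: "\<Gamma>' = ptransport f \<Gamma>" by auto
  have "is_partition \<Gamma>'" using is_partition_ptransport[OF p inj] eq by simp
  moreover have "bij_betw f (pset \<Gamma>) (pset \<Gamma>')" using inj eq by (simp add: bij_betw_def)
  moreover have "(inv_into (pset \<Gamma>) f x, inv_into (pset \<Gamma>) f y) \<in> prel \<Gamma>" if "(x, y) \<in> prel \<Gamma>'" for x y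
    using that partition_prel_in[OF p] inj by (auto simp: eq prel_ptransport)
  ultimately show "piso \<Gamma> \<Gamma>' f"
    using p by (auto simp: piso_def pmor_def eq prel_ptransport intro: bij_betw_inv_into)
qed

lemma piso_ptransport:
  "is_partition \<Gamma> \<Longrightarrow> inj_on f (pset \<Gamma>) \<Longrightarrow> piso \<Gamma> (ptransport f \<Gamma>) f"
  by (simp add: piso_iff)

lemma piso_comp: "piso \<Gamma> \<Gamma>' f \<Longrightarrow> piso \<Gamma>' \<Gamma>'' g \<Longrightarrow> piso \<Gamma> \<Gamma>'' (g \<circ> f)"
  by (auto simp: piso_iff ptransport_comp intro: comp_inj_on)

lemma piso_cong: "piso \<Gamma> \<Gamma>' f \<Longrightarrow> (\<And>x. x \<in> pset \<Gamma> \<Longrightarrow> f x = g x) \<Longrightarrow> piso \<Gamma> \<Gamma>' g"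
  using ptransport_cong[of \<Gamma> f g] inj_on_cong[of "pset \<Gamma>" f g] by (simp add: piso_iff)

lemma piso_id: "is_partition \<Gamma> \<Longrightarrow> piso \<Gamma> \<Gamma> id"
  by (simp add: piso_iff)

lemma piso_inv_into: "piso \<Gamma> \<Gamma>' f \<Longrightarrow> piso \<Gamma>' \<Gamma> (inv_into (pset \<Gamma>) f)"
  by (auto simp: piso_iff ptransport_inv_into is_partition_ptransport intro: inj_on_inv_into)

lemma piso_pmor: "piso \<Gamma> \<Gamma>' f \<Longrightarrow> pmor \<Gamma> \<Gamma>' f"
  by (simp add: piso_def)

lemma piso_partition: "piso \<Gamma> \<Gamma>' f \<Longrightarrow> is_partition \<Gamma>" "piso \<Gamma> \<Gamma>' f \<Longrightarrow> is_partition \<Gamma>'"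
  by (auto simp: piso_def pmor_def)

section \<open>Refinements\<close>

lemma ple_iff:
  "ple \<Lambda> \<Omega> \<longleftrightarrow> is_partition \<Lambda> \<and> is_partition \<Omega> \<and> pset \<Lambda> = pset \<Omega> \<and> prel \<Lambda> \<subseteq> prel \<Omega>"
  by (auto simp: ple_def pmor_def)

lemma ple_refl: "is_partition \<Lambda> \<Longrightarrow> ple \<Lambda> \<Lambda>"
  by (simp add: ple_iff)

lemma ple_ptransport:
  assumes "ple \<Lambda> \<Omega>" "inj_on f (pset \<Omega>)"
  shows "ple (ptransport f \<Lambda>) (ptransport f \<Omega>)"
  using assms by (auto simp: ple_iff is_partition_ptransport prel_ptransport)

text \<open>Transport along an injection can be undone, so it cannot merge two different partitions
  of the same set.\<close>

lemma pless_ptransport: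
  assumes "pless \<Lambda> \<Omega>" "inj_on f (pset \<Omega>)"
  shows "pless (ptransport f \<Lambda>) (ptransport f \<Omega>)"
proof -
  have le: "ple \<Lambda> \<Omega>" and ne: "\<Lambda> \<noteq> \<Omega>" using assms(1) by (auto simp: pless_def)
  have "ptransport f \<Lambda> \<noteq> ptransport f \<Omega>"
    using ptransport_inv_into[of \<Lambda> f] ptransport_inv_into[of \<Omega> f] le ne assms(2)
    by (auto simp: ple_iff)
  then show ?thesis using ple_ptransport[OF le assms(2)] by (simp add: pless_def)
qed

lemma pless_partition: "pless \<Lambda> \<Omega> \<Longrightarrow> is_partition \<Lambda>" "pless \<Lambda> \<Omega> \<Longrightarrow> is_partition \<Omega>"
  by (auto simp: pless_def ple_iff)

lemma pless_pmor: "pless \<Lambda> \<Omega> \<Longrightarrow> pmor \<Lambda> \<Omega> id"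
  by (auto simp: pless_def ple_def)

text \<open>\<open>Tr_ideal\<close> uses a \<open>finsum\<close> over this set, and over an infinite
  set that would be the default value zero. Proper refinements are relations on a finite set; if
  \<Gamma> is not a partition there are none.\<close>

lemma finite_pless: "finite {\<Omega>. pless \<Omega> \<Gamma>}"
proof (cases "is_partition \<Gamma>")
  case True
  then have "finite (pset \<Gamma>)" by (simp add: is_partition_def)
  moreover have "{\<Omega>. pless \<Omega> \<Gamma>} \<subseteq> {pset \<Gamma>} \<times> Pow (pset \<Gamma> \<times> pset \<Gamma>)"
    using partition_prel_in[OF True] by (auto simp: pless_def ple_iff)
  ultimately show ?thesis by (auto intro: finite_subset)
next
  case False
  then show ?thesis by (simp add: pless_def ple_iff)
qed

lemma mem_refinements: "\<Gamma> \<in> refinements \<Lambda> \<longleftrightarrow> ple \<Gamma> \<Lambda>"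
  by (simp add: refinements_def)

section \<open>Indiscrete partitions and block-preserving permutations\<close>

lemma is_partition_indiscrete [simp]: "is_partition (indiscrete B) \<longleftrightarrow> finite B"
  by (auto simp: is_partition_def indiscrete_def equiv_def refl_on_def sym_def trans_def)

lemma is_partition_ul [simp]: "is_partition (ul m)"
  by (simp add: ul_def)

lemma pset_indiscrete [simp]: "pset (indiscrete B) = B"
  by (simp add: indiscrete_def)

lemma pset_ul [simp]: "pset (ul m) = {1..m}"
  by (simp add: ul_def)

lemma ptransport_indiscrete: "ptransport f (indiscrete B) = indiscrete (f ` B)"
  by (auto simp: ptransport_def indiscrete_def)

lemma ple_indiscrete_iff: "ple \<Gamma> (indiscrete B) \<longleftrightarrow> is_partition \<Gamma> \<and> pset \<Gamma> = B"
proof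
  assume "is_partition \<Gamma> \<and> pset \<Gamma> = B"
  then show "ple \<Gamma> (indiscrete B)"
    using partition_prel_in[of \<Gamma>] is_partition_indiscrete[of B]
    by (auto simp: ple_iff indiscrete_def is_partition_def)
qed (simp add: ple_iff)

lemma ple_ul_iff: "ple \<Gamma> (ul m) \<longleftrightarrow> is_partition \<Gamma> \<and> pset \<Gamma> = {1..m}"
  by (simp add: ul_def ple_indiscrete_iff)

text \<open>Since \<sigma> maps every block onto itself, each point is related in \<Lambda> to its
  preimage; transitivity then keeps the transported relation inside that of \<Lambda>.\<close>

lemma block_group_ptransport_inv:
  assumes "\<sigma> \<in> block_group \<Lambda>" "ple \<Gamma> \<Lambda>"
  shows "ple (ptransport (inv_into UNIV \<sigma>) \<Gamma>) \<Lambda>"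
proof -
  have perm: "\<sigma> permutes pset \<Lambda>" and bl: "\<And>B. B \<in> blocks \<Lambda> \<Longrightarrow> \<sigma> ` B = B"
    using assms(1) by (auto simp: block_group_def)
  have iperm: "inv_into UNIV \<sigma> permutes pset \<Lambda>" using perm by (rule permutes_inv)
  have eq: "equiv (pset \<Lambda>) (prel \<Lambda>)" using assms(2) by (simp add: ple_iff is_partition_def)
  have rel: "(x, inv_into UNIV \<sigma> x) \<in> prel \<Lambda>" if "x \<in> pset \<Lambda>" for x
  proof -
    have B: "prel \<Lambda> `` {x} \<in> blocks \<Lambda>" using that by (simp add: blocks_def quotientI)
    have "x \<in> prel \<Lambda> `` {x}" using equiv_class_self[OF eq that] .
    then have "x \<in> \<sigma> ` (prel \<Lambda> `` {x})" using bl[OF B] by simp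
    then have "inv_into UNIV \<sigma> x \<in> prel \<Lambda> `` {x}"
      using perm by (auto simp: permutes_inj inv_f_f)
    then show ?thesis by simp
  qed
  have "prel (ptransport (inv_into UNIV \<sigma>) \<Gamma>) \<subseteq> prel \<Lambda>"
  proof (rule subrelI)
    fix x y assume "(x, y) \<in> prel (ptransport (inv_into UNIV \<sigma>) \<Gamma>)"
    then obtain a b where ab: "(a, b) \<in> prel \<Lambda>" "x = inv_into UNIV \<sigma> a" "y = inv_into UNIV \<sigma> b"
      using assms(2) by (auto simp: prel_ptransport ple_iff)
    then have "a \<in> pset \<Lambda>" "b \<in> pset \<Lambda>"
      using assms(2) partition_prel_in[of \<Lambda>] by (auto simp: ple_iff)
    then show "(x, y) \<in> prel \<Lambda>"
      using rel[of a] rel[of b] ab eq unfolding equiv_def by (metis symD transD)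
  qed
  moreover have "is_partition (ptransport (inv_into UNIV \<sigma>) \<Gamma>)"
    using assms(2) iperm by (auto simp: ple_iff intro!: is_partition_ptransport permutes_inj_on)
  moreover have "inv_into UNIV \<sigma> ` pset \<Gamma> = pset \<Lambda>"
    using assms(2) iperm by (simp add: ple_iff permutes_image)
  ultimately show ?thesis using assms(2) by (simp add: ple_iff)
qed

lemma block_group_piso:
  assumes "\<sigma> \<in> block_group \<Lambda>" "ple \<Gamma> \<Lambda>"
  shows "piso (ptransport (inv_into UNIV \<sigma>) \<Gamma>) \<Gamma> \<sigma>"
proof -
  have perm: "\<sigma> permutes pset \<Lambda>"
    using assms(1) by (auto simp: block_group_def)
  have "ptransport \<sigma> (ptransport (inv_into UNIV \<sigma>) \<Gamma>) = \<Gamma>"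
    using perm by (simp flip: ptransport_comp add: permutes_inv_o)
  then show ?thesis
    using block_group_ptransport_inv[OF assms] perm
    by (simp add: piso_iff ple_iff permutes_inj_on)
qed

text \<open>The only possible block of \<open>ul m\<close> is the whole set, which every permutation
  preserves. Invariance of \<open>r m\<close> under the full symmetric group is what allows blocks
  to be moved to any position.\<close>

lemma block_group_ul: "block_group (ul m) = {\<sigma>. \<sigma> permutes {1..m}}"
proof -
  have "\<sigma> ` B = B" if "\<sigma> permutes {1..m}" "B \<in> blocks (ul m)" for \<sigma> B
  proof -
    have "B = {1..m}"
      using that(2) by (auto simp: blocks_def ul_def indiscrete_def quotient_def)
    then show ?thesis using that(1) by (simp add: permutes_image)
  qed
  then show ?thesis by (auto simp: block_group_def)
qed

subsection \<open>Disjoint unions\<close>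

lemma copair_inl [simp]: "copair f g (inl x) = f x"
  by (simp add: copair_def)

lemma copair_inr [simp]: "copair f g (inr x) = g x"
  by (simp add: copair_def)

lemma inl_neq_inr [simp]: "inl x \<noteq> inr y" "inr y \<noteq> inl x"
  by (metis sum_encode_inverse Inl_Inr_False)+

lemma inl_inr_inject [simp]: "inl x = inl y \<longleftrightarrow> x = y" "inr x = inr y \<longleftrightarrow> x = y"
  by (metis sum_encode_inverse Inl_inject, metis sum_encode_inverse Inr_inject)

text \<open>Every natural number decodes to a left or a right summand, so the equality holds
  everywhere and not just on the points of a partition. It lets \<open>Ext_Tr\<close> be applied
  with an inclusion of refinements on one side and the identity on the other.\<close>

lemma sum_map_id [simp]: "sum_map id id = id"
proof
  fix n
  show "sum_map id id n = id n"
    using sum_decode_inverse[of n]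
    by (cases "sum_decode n") (simp_all add: sum_map_def copair_def)
qed

lemma pset_psum [simp]: "pset (psum \<Lambda> \<Omega>) = inl ` pset \<Lambda> \<union> inr ` pset \<Omega>"
  by (simp add: psum_def)

lemma prel_psum: "prel (psum \<Lambda> \<Omega>) = map_prod inl inl ` prel \<Lambda> \<union> map_prod inr inr ` prel \<Omega>"
  by (simp add: psum_def)

lemma left_part_psum [simp]: "left_part (psum \<Gamma> \<Theta>) = \<Gamma>"
  by (auto simp: left_part_def psum_def map_prod_def prod_eq_iff)

lemma right_part_psum [simp]: "right_part (psum \<Gamma> \<Theta>) = \<Theta>"
  by (auto simp: right_part_def psum_def map_prod_def prod_eq_iff)

lemma is_partition_psum:
  assumes "is_partition \<Lambda>" "is_partition \<Omega>"
  shows "is_partition (psum \<Lambda> \<Omega>)"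
proof -
  have eq: "equiv (pset \<Lambda>) (prel \<Lambda>)" "equiv (pset \<Omega>) (prel \<Omega>)"
    and fin: "finite (pset (psum \<Lambda> \<Omega>))"
    using assms by (auto simp: is_partition_def)
  have "equiv (pset (psum \<Lambda> \<Omega>)) (prel (psum \<Lambda> \<Omega>))"
  proof (rule equivI)
    show "prel (psum \<Lambda> \<Omega>) \<subseteq> pset (psum \<Lambda> \<Omega>) \<times> pset (psum \<Lambda> \<Omega>)"
      using partition_prel_in[OF assms(1)] partition_prel_in[OF assms(2)] by (auto simp: prel_psum)
    show "refl_on (pset (psum \<Lambda> \<Omega>)) (prel (psum \<Lambda> \<Omega>))"
      using eq by (auto simp: prel_psum equiv_def refl_on_def)
    show "sym (prel (psum \<Lambda> \<Omega>))"
      using eq by (auto simp: prel_psum equiv_def sym_def)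
    show "trans (prel (psum \<Lambda> \<Omega>))"
      using eq by (auto simp: prel_psum equiv_def image_iff intro!: transI dest: transD)
  qed
  then show ?thesis using fin by (simp add: is_partition_def)
qed

lemma ple_psum: "ple \<Gamma> \<Lambda> \<Longrightarrow> ple \<Theta> \<Omega> \<Longrightarrow> ple (psum \<Gamma> \<Theta>) (psum \<Lambda> \<Omega>)"
  by (auto simp: ple_iff is_partition_psum prel_psum)

lemma pless_psum_left: "pless \<Gamma> \<Lambda> \<Longrightarrow> is_partition \<Omega> \<Longrightarrow> pless (psum \<Gamma> \<Omega>) (psum \<Lambda> \<Omega>)"
proof -
  have "psum \<Gamma> \<Omega> \<noteq> psum \<Lambda> \<Omega>" if "\<Gamma> \<noteq> \<Lambda>" using that by (metis left_part_psum)
  then show "pless \<Gamma> \<Lambda> \<Longrightarrow> is_partition \<Omega> \<Longrightarrow> ?thesis"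
    by (auto simp: pless_def intro: ple_psum ple_refl)
qed

lemma pless_psum_right: "pless \<Gamma> \<Omega> \<Longrightarrow> is_partition \<Lambda> \<Longrightarrow> pless (psum \<Lambda> \<Gamma>) (psum \<Lambda> \<Omega>)"
proof -
  have "psum \<Lambda> \<Gamma> \<noteq> psum \<Lambda> \<Omega>" if "\<Gamma> \<noteq> \<Omega>" using that by (metis right_part_psum)
  then show "pless \<Gamma> \<Omega> \<Longrightarrow> is_partition \<Lambda> \<Longrightarrow> ?thesis"
    by (auto simp: pless_def intro: ple_psum ple_refl)
qed

lemma ptransport_copair:
  "ptransport (copair f g) (psum \<Lambda> \<Omega>) =
    (f ` pset \<Lambda> \<union> g ` pset \<Omega>, map_prod f f ` prel \<Lambda> \<union> map_prod g g ` prel \<Omega>)"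
  by (simp add: ptransport_def psum_def image_Un image_image map_prod_def case_prod_unfold)

lemma piso_sum_map:
  assumes "piso \<Lambda> \<Lambda>' f" "piso \<Omega> \<Omega>' g"
  shows "piso (psum \<Lambda> \<Omega>) (psum \<Lambda>' \<Omega>') (sum_map f g)"
proof -
  have "ptransport (sum_map f g) (psum \<Lambda> \<Omega>) = psum (ptransport f \<Lambda>) (ptransport g \<Omega>)"
    by (simp add: sum_map_def ptransport_copair)
      (simp add: psum_def ptransport_def image_image map_prod_def case_prod_unfold)
  moreover have "inj_on (sum_map f g) (pset (psum \<Lambda> \<Omega>))"
  proof -
    have "inj_on f (pset \<Lambda>)" "inj_on g (pset \<Omega>)" using assms by (simp_all add: piso_iff)
    then show ?thesis
      by (intro inj_onI) (auto simp: sum_map_def dest: inj_onD)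
  qed
  ultimately show ?thesis
    using assms by (simp add: piso_iff is_partition_psum)
qed

text \<open>Points are counted from 1, so the right-hand points land in \<open>{i+1..i+j}\<close>
  and miss the left-hand ones.\<close>

lemma inj_on_juxtapose: "inj_on (juxtapose i) (inl ` {1..i} \<union> inr ` {1..j})"
  by (auto simp: juxtapose_def inj_on_def)

lemma image_juxtapose: "juxtapose i ` (inl ` {1..i} \<union> inr ` {1..j}) = {1..i + j}"
proof -
  have "juxtapose i ` (inl ` {1..i} \<union> inr ` {1..j}) = {1..i} \<union> (\<lambda>b. b + i) ` {1..j}"
    by (simp add: juxtapose_def image_Un image_image add.commute)
  also have "\<dots> = {1..i} \<union> {1 + i..j + i}"
    by (simp only: image_add_atLeastAtMost')
  also have "\<dots> = {1..i + j}" by auto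
  finally show ?thesis .
qed

section \<open>The quotients by proper transfers\<close>

context partition_ring
begin

section \<open>Transfers and the ideal of proper transfers\<close>

lemma Tr_closed: "pmor \<Lambda> \<Omega> f \<Longrightarrow> a \<in> carrier (Val R \<Lambda>) \<Longrightarrow> Tr R \<Lambda> \<Omega> f a \<in> carrier (Val R \<Omega>)"
  using Tr_hom[of \<Lambda> \<Omega> f] by (auto simp: hom_def)

lemma Tr_add:
  "pmor \<Lambda> \<Omega> f \<Longrightarrow> a \<in> carrier (Val R \<Lambda>) \<Longrightarrow> b \<in> carrier (Val R \<Lambda>) \<Longrightarrow>
    Tr R \<Lambda> \<Omega> f (a \<oplus>\<^bsub>Val R \<Lambda>\<^esub> b) = Tr R \<Lambda> \<Omega> f a \<oplus>\<^bsub>Val R \<Omega>\<^esub> Tr R \<Lambda> \<Omega> f b"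
  using Tr_hom[of \<Lambda> \<Omega> f] by (auto simp: hom_def)

lemma pmor_partition: "pmor \<Lambda> \<Omega> f \<Longrightarrow> is_partition \<Lambda>" "pmor \<Lambda> \<Omega> f \<Longrightarrow> is_partition \<Omega>"
  by (auto simp: pmor_def)

lemma Val_zero_closed: "is_partition \<Lambda> \<Longrightarrow> \<zero>\<^bsub>Val R \<Lambda>\<^esub> \<in> carrier (Val R \<Lambda>)"
  using cring by (intro cring.cring_simprules(2))

lemma Val_add_closed:
  "\<lbrakk>is_partition \<Lambda>; a \<in> carrier (Val R \<Lambda>); b \<in> carrier (Val R \<Lambda>)\<rbrakk> \<Longrightarrow>
    a \<oplus>\<^bsub>Val R \<Lambda>\<^esub> b \<in> carrier (Val R \<Lambda>)"
  using cring by (intro cring.cring_simprules(1))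

lemma Tr_abelian_group_hom: "pmor \<Lambda> \<Omega> f \<Longrightarrow> abelian_group_hom (Val R \<Lambda>) (Val R \<Omega>) (Tr R \<Lambda> \<Omega> f)"
  by (intro abelian_group_homI abelian group_hom.intro group_hom_axioms.intro Tr_hom
      abelian_group.a_group) (auto dest: pmor_partition)

lemma Tr_zero: "pmor \<Lambda> \<Omega> f \<Longrightarrow> Tr R \<Lambda> \<Omega> f \<zero>\<^bsub>Val R \<Lambda>\<^esub> = \<zero>\<^bsub>Val R \<Omega>\<^esub>"
  by (rule abelian_group_hom.hom_zero[OF Tr_abelian_group_hom])

text \<open>The definition gives an element as one sum with a coefficient for every proper
  refinement. This rule replaces that form by additive generation, so that later arguments only have
  to treat zero, a sum and a single transfer.\<close>

lemma Tr_ideal_induct [consumes 2, case_names zero add Tr]: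
  assumes "a \<in> Tr_ideal R \<Gamma>" "is_partition \<Gamma>"
    and zero: "P \<zero>\<^bsub>Val R \<Gamma>\<^esub>"
    and add: "\<And>a b. \<lbrakk>a \<in> carrier (Val R \<Gamma>); b \<in> carrier (Val R \<Gamma>); P a; P b\<rbrakk> \<Longrightarrow>
      P (a \<oplus>\<^bsub>Val R \<Gamma>\<^esub> b)"
    and Tr: "\<And>\<Omega> c. \<lbrakk>pless \<Omega> \<Gamma>; c \<in> carrier (Val R \<Omega>)\<rbrakk> \<Longrightarrow> P (Tr R \<Omega> \<Gamma> id c)"
  shows "P a"
proof -
  interpret V: abelian_group "Val R \<Gamma>" using assms(2) by (rule abelian)
  obtain c where c: "\<And>\<Omega>. pless \<Omega> \<Gamma> \<Longrightarrow> c \<Omega> \<in> carrier (Val R \<Omega>)"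
    and a: "a = (\<Oplus>\<^bsub>Val R \<Gamma>\<^esub>\<Omega>\<in>{\<Omega>. pless \<Omega> \<Gamma>}. Tr R \<Omega> \<Gamma> id (c \<Omega>))"
    using assms(1) by (auto simp: Tr_ideal_def)
  define t where "t \<Omega> = Tr R \<Omega> \<Gamma> id (c \<Omega>)" for \<Omega>
  have t: "t \<Omega> \<in> carrier (Val R \<Gamma>)" "P (t \<Omega>)" if "pless \<Omega> \<Gamma>" for \<Omega>
    unfolding t_def using Tr_closed[OF pless_pmor] Tr c that by blast+
  \<comment> \<open>Passing to partial sums over subsets of the index set makes the induction
    possible; the full index set is the case that is wanted.\<close>
  have "finite A \<Longrightarrow> A \<subseteq> {\<Omega>. pless \<Omega> \<Gamma>} \<Longrightarrow> P (\<Oplus>\<^bsub>Val R \<Gamma>\<^esub>\<Omega>\<in>A. t \<Omega>)" for A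
  proof (induction A rule: finite_induct)
    case (insert \<Omega> A)
    then have "t \<in> A \<rightarrow> carrier (Val R \<Gamma>)" "t \<Omega> \<in> carrier (Val R \<Gamma>)" "P (t \<Omega>)"
      by (blast intro: t)+
    with insert show ?case by (simp add: add)
  qed (use zero in simp)
  then show ?thesis using a finite_pless by (simp add: t_def)
qed

lemma Tr_ideal_closed:
  assumes "a \<in> Tr_ideal R \<Gamma>" "is_partition \<Gamma>"
  shows "a \<in> carrier (Val R \<Gamma>)"
proof -
  interpret V: abelian_group "Val R \<Gamma>" using assms(2) by (rule abelian)
  show ?thesis
    using assms by (induction rule: Tr_ideal_induct) (auto intro: Tr_closed pless_pmor)
qed

lemma Tr_ideal_zero:
  assumes "is_partition \<Gamma>"
  shows "\<zero>\<^bsub>Val R \<Gamma>\<^esub> \<in> Tr_ideal R \<Gamma>"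
proof -
  interpret V: abelian_group "Val R \<Gamma>" using assms by (rule abelian)
  have "(\<Oplus>\<^bsub>Val R \<Gamma>\<^esub>\<Omega>\<in>{\<Omega>. pless \<Omega> \<Gamma>}. Tr R \<Omega> \<Gamma> id \<zero>\<^bsub>Val R \<Omega>\<^esub>) = \<zero>\<^bsub>Val R \<Gamma>\<^esub>"
    by (intro V.add.finprod_one_eqI) (auto simp: Tr_zero pless_pmor)
  moreover have "\<zero>\<^bsub>Val R \<Omega>\<^esub> \<in> carrier (Val R \<Omega>)" if "pless \<Omega> \<Gamma>" for \<Omega>
    using pless_partition(1)[OF that] by (rule Val_zero_closed)
  ultimately show ?thesis unfolding Tr_ideal_def by force
qed

lemma Tr_ideal_add:
  assumes "a \<in> Tr_ideal R \<Gamma>" "b \<in> Tr_ideal R \<Gamma>" "is_partition \<Gamma>"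
  shows "a \<oplus>\<^bsub>Val R \<Gamma>\<^esub> b \<in> Tr_ideal R \<Gamma>"
proof -
  interpret V: abelian_group "Val R \<Gamma>" using assms(3) by (rule abelian)
  obtain c d where c: "\<And>\<Omega>. pless \<Omega> \<Gamma> \<Longrightarrow> c \<Omega> \<in> carrier (Val R \<Omega>)"
    and a: "a = (\<Oplus>\<^bsub>Val R \<Gamma>\<^esub>\<Omega>\<in>{\<Omega>. pless \<Omega> \<Gamma>}. Tr R \<Omega> \<Gamma> id (c \<Omega>))"
    and d: "\<And>\<Omega>. pless \<Omega> \<Gamma> \<Longrightarrow> d \<Omega> \<in> carrier (Val R \<Omega>)"
    and b: "b = (\<Oplus>\<^bsub>Val R \<Gamma>\<^esub>\<Omega>\<in>{\<Omega>. pless \<Omega> \<Gamma>}. Tr R \<Omega> \<Gamma> id (d \<Omega>))"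
    using assms(1,2) by (auto simp: Tr_ideal_def)
  \<comment> \<open>Both sums run over the same refinements, so the coefficients add
    termwise.\<close>
  define e where "e \<Omega> = c \<Omega> \<oplus>\<^bsub>Val R \<Omega>\<^esub> d \<Omega>" for \<Omega>
  have e: "e \<Omega> \<in> carrier (Val R \<Omega>)" if "pless \<Omega> \<Gamma>" for \<Omega>
    unfolding e_def using c[OF that] d[OF that] pless_partition(1)[OF that] by (intro Val_add_closed)
  have cl: "Tr R \<Omega> \<Gamma> id (x \<Omega>) \<in> carrier (Val R \<Gamma>)"
    if "pless \<Omega> \<Gamma>" "\<And>\<Omega>. pless \<Omega> \<Gamma> \<Longrightarrow> x \<Omega> \<in> carrier (Val R \<Omega>)" for \<Omega> x
    using that Tr_closed pless_pmor by blast
  have "a \<oplus>\<^bsub>Val R \<Gamma>\<^esub> b =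
      (\<Oplus>\<^bsub>Val R \<Gamma>\<^esub>\<Omega>\<in>{\<Omega>. pless \<Omega> \<Gamma>}. Tr R \<Omega> \<Gamma> id (c \<Omega>) \<oplus>\<^bsub>Val R \<Gamma>\<^esub> Tr R \<Omega> \<Gamma> id (d \<Omega>))"
    unfolding a b using cl c d by (subst V.finsum_addf) auto
  also have "\<dots> = (\<Oplus>\<^bsub>Val R \<Gamma>\<^esub>\<Omega>\<in>{\<Omega>. pless \<Omega> \<Gamma>}. Tr R \<Omega> \<Gamma> id (e \<Omega>))"
    using cl[of _ e] e c d by (intro V.finsum_cong') (auto simp: e_def Tr_add pless_pmor)
  finally show ?thesis unfolding Tr_ideal_def using e by blast
qed

lemma Tr_ideal_Tr:
  assumes "pless \<Omega> \<Gamma>" "a \<in> carrier (Val R \<Omega>)"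
  shows "Tr R \<Omega> \<Gamma> id a \<in> Tr_ideal R \<Gamma>"
proof -
  interpret V: abelian_group "Val R \<Gamma>" using pless_partition(2)[OF assms(1)] by (rule abelian)
  \<comment> \<open>All coefficients but one are zero, and transfers preserve zero.\<close>
  define c where "c \<Psi> = (if \<Psi> = \<Omega> then a else \<zero>\<^bsub>Val R \<Psi>\<^esub>)" for \<Psi>
  have c: "c \<Psi> \<in> carrier (Val R \<Psi>)" if "pless \<Psi> \<Gamma>" for \<Psi>
    using Val_zero_closed[OF pless_partition(1)[OF that]] assms(2) by (simp add: c_def)
  have cl: "Tr R \<Omega> \<Gamma> id a \<in> carrier (Val R \<Gamma>)"
    using assms Tr_closed pless_pmor by blast
  have "(\<Oplus>\<^bsub>Val R \<Gamma>\<^esub>\<Psi>\<in>{\<Psi>. pless \<Psi> \<Gamma>}. Tr R \<Psi> \<Gamma> id (c \<Psi>)) =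
      (\<Oplus>\<^bsub>Val R \<Gamma>\<^esub>\<Psi>\<in>{\<Psi>. pless \<Psi> \<Gamma>}. if \<Omega> = \<Psi> then Tr R \<Omega> \<Gamma> id a else \<zero>\<^bsub>Val R \<Gamma>\<^esub>)"
    using cl by (intro V.finsum_cong') (auto simp: c_def Tr_zero pless_pmor)
  also have "\<dots> = Tr R \<Omega> \<Gamma> id a"
    using assms(1) cl finite_pless
    by (subst V.add.finprod_singleton[where f = "\<lambda>_. Tr R \<Omega> \<Gamma> id a"]) auto
  finally show ?thesis unfolding Tr_ideal_def using c by force
qed

text \<open>On a single transfer the Frobenius identity moves the factor inside as a restriction,
  \<open>x * Tr c = Tr (Res x * c)\<close>.\<close>

lemma Tr_ideal_mult:
  assumes "a \<in> Tr_ideal R \<Gamma>" "is_partition \<Gamma>" "x \<in> carrier (Val R \<Gamma>)"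
  shows "x \<otimes>\<^bsub>Val R \<Gamma>\<^esub> a \<in> Tr_ideal R \<Gamma>"
proof -
  interpret V: cring "Val R \<Gamma>" using assms(2) by (rule cring)
  show ?thesis
    using assms(1,2)
  proof (induction rule: Tr_ideal_induct)
    case zero
    then show ?case using assms by (simp add: Tr_ideal_zero)
  next
    case (add a b)
    then show ?case using assms by (simp add: V.r_distr Tr_ideal_add)
  next
    case (Tr \<Omega> c)
    then have pm: "pmor \<Omega> \<Gamma> id" and p: "is_partition \<Omega>" by (simp_all add: pless_pmor pless_partition)
    interpret W: cring "Val R \<Omega>" using p by (rule cring)
    have "Res R \<Omega> \<Gamma> id x \<in> carrier (Val R \<Omega>)"
      using Res_ring_hom[OF pm] assms(3) by (rule ring_hom_closed)
    then show ?case
      using Tr assms(3) Tr_ideal_Tr by (simp flip: Frobenius[OF pm])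
  qed
qed

lemma ideal_Tr_ideal:
  assumes "is_partition \<Gamma>"
  shows "ideal (Tr_ideal R \<Gamma>) (Val R \<Gamma>)"
proof -
  interpret V: cring "Val R \<Gamma>" using assms by (rule cring)
  show ?thesis
  proof (rule idealI)
    show "ring (Val R \<Gamma>)" by (rule V.ring_axioms)
    show "subgroup (Tr_ideal R \<Gamma>) (add_monoid (Val R \<Gamma>))"
    proof (rule V.add.subgroupI)
      show "Tr_ideal R \<Gamma> \<subseteq> carrier (Val R \<Gamma>)" using Tr_ideal_closed assms by blast
      show "Tr_ideal R \<Gamma> \<noteq> {}" using Tr_ideal_zero[OF assms] by blast
      fix a assume a: "a \<in> Tr_ideal R \<Gamma>"
      then have "a \<in> carrier (Val R \<Gamma>)" using assms by (rule Tr_ideal_closed)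
      \<comment> \<open>Negation is multiplication by minus one, so closure under negatives follows
        from absorption.\<close>
      moreover have "(\<ominus>\<^bsub>Val R \<Gamma>\<^esub> \<one>\<^bsub>Val R \<Gamma>\<^esub>) \<otimes>\<^bsub>Val R \<Gamma>\<^esub> a \<in> Tr_ideal R \<Gamma>"
        using a assms by (intro Tr_ideal_mult) auto
      ultimately show "\<ominus>\<^bsub>Val R \<Gamma>\<^esub> a \<in> Tr_ideal R \<Gamma>" by (simp add: V.l_minus)
    qed (simp add: Tr_ideal_add assms)
  qed (use Tr_ideal_mult Tr_ideal_closed assms V.m_comm in metis)+
qed

section \<open>The quotient rings and their classes\<close>

lemma cring_Bar: "is_partition \<Gamma> \<Longrightarrow> cring (Bar R \<Gamma>)"
  unfolding Bar_def using cring ideal_Tr_ideal by (intro ideal.quotient_is_cring)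

lemma Bar_class_hom: "is_partition \<Gamma> \<Longrightarrow> Bar_class R \<Gamma> \<in> ring_hom (Val R \<Gamma>) (Bar R \<Gamma>)"
  unfolding Bar_def Bar_class_def[abs_def] by (intro ideal.rcos_ring_hom ideal_Tr_ideal)

lemma Bar_class_closed:
  "is_partition \<Gamma> \<Longrightarrow> a \<in> carrier (Val R \<Gamma>) \<Longrightarrow> Bar_class R \<Gamma> a \<in> carrier (Bar R \<Gamma>)"
  using Bar_class_hom by (rule ring_hom_closed)

lemma Bar_class_add:
  "\<lbrakk>is_partition \<Gamma>; a \<in> carrier (Val R \<Gamma>); b \<in> carrier (Val R \<Gamma>)\<rbrakk> \<Longrightarrow>
    Bar_class R \<Gamma> (a \<oplus>\<^bsub>Val R \<Gamma>\<^esub> b) = Bar_class R \<Gamma> a \<oplus>\<^bsub>Bar R \<Gamma>\<^esub> Bar_class R \<Gamma> b"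
  by (rule ring_hom_add[OF Bar_class_hom])

lemma Bar_class_zero:
  assumes "is_partition \<Gamma>"
  shows "Bar_class R \<Gamma> \<zero>\<^bsub>Val R \<Gamma>\<^esub> = \<zero>\<^bsub>Bar R \<Gamma>\<^esub>"
  using ring_hom_zero[OF Bar_class_hom] assms cring cring_Bar cring.axioms(1) by metis

lemma Bar_carrierE:
  assumes "A \<in> carrier (Bar R \<Gamma>)"
  obtains a where "a \<in> carrier (Val R \<Gamma>)" "A = Bar_class R \<Gamma> a"
  using assms by (auto simp: Bar_def Bar_class_def FactRing_def A_RCOSETS_def' a_r_coset_def')

lemma mem_Bar_class: "b \<in> Bar_class R \<Gamma> a \<longleftrightarrow> (\<exists>i\<in>Tr_ideal R \<Gamma>. b = i \<oplus>\<^bsub>Val R \<Gamma>\<^esub> a)"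
  by (auto simp: Bar_class_def a_r_coset_def')

text \<open>This is the form in which well-definedness of the induced maps is checked: by
  \<open>mem_Bar_class\<close>, another representative arises by adding an ideal element on the
  left.\<close>

lemma Bar_class_ideal_add:
  assumes "is_partition \<Gamma>" "i \<in> Tr_ideal R \<Gamma>" "a \<in> carrier (Val R \<Gamma>)"
  shows "Bar_class R \<Gamma> (i \<oplus>\<^bsub>Val R \<Gamma>\<^esub> a) = Bar_class R \<Gamma> a"
proof -
  interpret V: cring "Val R \<Gamma>" using assms(1) by (rule cring)
  interpret B: cring "Bar R \<Gamma>" using assms(1) by (rule cring_Bar)
  interpret I: ideal "Tr_ideal R \<Gamma>" "Val R \<Gamma>" using assms(1) by (rule ideal_Tr_ideal)
  have "Bar_class R \<Gamma> i = \<zero>\<^bsub>Bar R \<Gamma>\<^esub>"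
    using assms(2) I.a_subgroup unfolding Bar_class_def Bar_def FactRing_def
    by (simp add: V.a_coset_join2 I.a_Hcarr)
  then show ?thesis
    using assms Bar_class_add[of \<Gamma> i a] Bar_class_closed[of \<Gamma> a] by (simp add: Tr_ideal_closed)
qed

lemma Bar_class_self:
  assumes "is_partition \<Gamma>" "a \<in> carrier (Val R \<Gamma>)"
  shows "a \<in> Bar_class R \<Gamma> a"
proof -
  interpret V: cring "Val R \<Gamma>" using assms(1) by (rule cring)
  show ?thesis using assms(2) Tr_ideal_zero[OF assms(1)] by (auto simp: mem_Bar_class intro!: bexI[of _ "\<zero>\<^bsub>Val R \<Gamma>\<^esub>"])
qed

text \<open>Transferring from \<Omega> to \<Gamma> and then along \<open>f\<close> equals
  transferring along \<open>f\<close> to the transport of \<Omega> and then up to \<Gamma>'. The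
  transport is again a proper refinement, so the result lies in the ideal.\<close>

lemma Tr_piso_Tr_ideal:
  assumes iso: "piso \<Gamma> \<Gamma>' f" and "a \<in> Tr_ideal R \<Gamma>"
  shows "Tr R \<Gamma> \<Gamma>' f a \<in> Tr_ideal R \<Gamma>'"
  using assms(2) piso_partition(1)[OF iso]
proof (induction rule: Tr_ideal_induct)
  case zero
  then show ?case using iso by (simp add: Tr_zero piso_pmor Tr_ideal_zero piso_partition)
next
  case (add a b)
  then show ?case
    using iso by (simp add: Tr_add piso_pmor piso_partition(2) Tr_ideal_add)
next
  case (Tr \<Omega> c)
  let ?\<Omega>' = "ptransport f \<Omega>"
  have inj: "inj_on f (pset \<Gamma>)" and \<Gamma>': "\<Gamma>' = ptransport f \<Gamma>" using iso by (auto simp: piso_iff)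
  have "pset \<Omega> = pset \<Gamma>" "is_partition \<Omega>" using Tr(1) by (auto simp: pless_def ple_iff)
  then have isoO: "piso \<Omega> ?\<Omega>' f" using inj by (simp add: piso_ptransport)
  have less: "pless ?\<Omega>' \<Gamma>'" unfolding \<Gamma>' using Tr(1) inj by (rule pless_ptransport)
  have "Tr R \<Gamma> \<Gamma>' f (Tr R \<Omega> \<Gamma> id c) = Tr R \<Omega> \<Gamma>' (f \<circ> id) c"
    using Tr_comp[OF pless_pmor[OF Tr(1)] piso_pmor[OF iso] Tr(2)] by simp
  also have "\<dots> = Tr R ?\<Omega>' \<Gamma>' id (Tr R \<Omega> ?\<Omega>' f c)"
    using Tr_comp[OF piso_pmor[OF isoO] pless_pmor[OF less] Tr(2)] by simp
  finally show ?case
    using less Tr(2) isoO by (simp add: Tr_ideal_Tr Tr_closed piso_pmor)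
qed

subsection \<open>Isomorphisms\<close>

text \<open>All representatives of the coset yield the same class, and the coset contains
  \<open>a\<close>, so the union in \<open>Bar_Tr\<close> collapses to a single class.\<close>

lemma Bar_Tr_class:
  assumes iso: "piso \<Gamma> \<Gamma>' f" and a: "a \<in> carrier (Val R \<Gamma>)"
  shows "Bar_Tr R \<Gamma> \<Gamma>' f (Bar_class R \<Gamma> a) = Bar_class R \<Gamma>' (Tr R \<Gamma> \<Gamma>' f a)"
proof -
  note p = piso_partition[OF iso]
  have "Bar_class R \<Gamma>' (Tr R \<Gamma> \<Gamma>' f b) = Bar_class R \<Gamma>' (Tr R \<Gamma> \<Gamma>' f a)"
    if b: "b \<in> Bar_class R \<Gamma> a" for b
  proof -
    obtain i where i: "i \<in> Tr_ideal R \<Gamma>" "b = i \<oplus>\<^bsub>Val R \<Gamma>\<^esub> a"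
      using b by (auto simp: mem_Bar_class)
    have "Tr R \<Gamma> \<Gamma>' f b = Tr R \<Gamma> \<Gamma>' f i \<oplus>\<^bsub>Val R \<Gamma>'\<^esub> Tr R \<Gamma> \<Gamma>' f a"
      using i a iso p by (simp add: Tr_add piso_pmor Tr_ideal_closed)
    then show ?thesis
      using i a p iso by (simp add: Bar_class_ideal_add Tr_piso_Tr_ideal Tr_closed piso_pmor)
  qed
  then show ?thesis
    unfolding Bar_Tr_def using Bar_class_self[OF p(1) a] by blast
qed

lemma Bar_Tr_closed:
  assumes "piso \<Gamma> \<Gamma>' f" "A \<in> carrier (Bar R \<Gamma>)"
  shows "Bar_Tr R \<Gamma> \<Gamma>' f A \<in> carrier (Bar R \<Gamma>')"
  using assms
  by (elim Bar_carrierE) (simp add: Bar_Tr_class Bar_class_closed piso_partition(2) Tr_closed piso_pmor)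

lemma Bar_Tr_add:
  assumes "piso \<Gamma> \<Gamma>' f" "A \<in> carrier (Bar R \<Gamma>)" "B \<in> carrier (Bar R \<Gamma>)"
  shows "Bar_Tr R \<Gamma> \<Gamma>' f (A \<oplus>\<^bsub>Bar R \<Gamma>\<^esub> B) = Bar_Tr R \<Gamma> \<Gamma>' f A \<oplus>\<^bsub>Bar R \<Gamma>'\<^esub> Bar_Tr R \<Gamma> \<Gamma>' f B"
proof -
  note p = piso_partition[OF assms(1)]
  interpret V: cring "Val R \<Gamma>" using p(1) by (rule cring)
  obtain a b where "a \<in> carrier (Val R \<Gamma>)" "A = Bar_class R \<Gamma> a"
    "b \<in> carrier (Val R \<Gamma>)" "B = Bar_class R \<Gamma> b"
    using assms(2,3) by (metis Bar_carrierE)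
  then show ?thesis
    using assms(1) p by (simp add: Bar_Tr_class Tr_closed piso_pmor Tr_add flip: Bar_class_add)
qed

lemma Bar_Tr_zero:
  assumes "piso \<Gamma> \<Gamma>' f"
  shows "Bar_Tr R \<Gamma> \<Gamma>' f \<zero>\<^bsub>Bar R \<Gamma>\<^esub> = \<zero>\<^bsub>Bar R \<Gamma>'\<^esub>"
proof -
  note p = piso_partition[OF assms(1)]
  interpret V: cring "Val R \<Gamma>" using p(1) by (rule cring)
  show ?thesis
    using assms p by (simp add: Bar_Tr_class Tr_zero piso_pmor flip: Bar_class_zero)
qed

lemma Bar_Tr_comp:
  assumes "piso \<Gamma> \<Gamma>' f" "piso \<Gamma>' \<Gamma>'' g" "A \<in> carrier (Bar R \<Gamma>)"
  shows "Bar_Tr R \<Gamma>' \<Gamma>'' g (Bar_Tr R \<Gamma> \<Gamma>' f A) = Bar_Tr R \<Gamma> \<Gamma>'' (g \<circ> f) A"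
  using assms(3)
proof (rule Bar_carrierE)
  fix a assume a: "a \<in> carrier (Val R \<Gamma>)" "A = Bar_class R \<Gamma> a"
  then show ?thesis
    using assms(1,2) piso_comp[OF assms(1,2)]
    by (simp add: Bar_Tr_class Tr_closed piso_pmor Tr_comp[of \<Gamma> \<Gamma>' f \<Gamma>'' g])
qed

text \<open>Maps that agree on the points are 2-isomorphic by reflexivity of the target relation,
  and transfers identify 2-isomorphic maps.\<close>

lemma Bar_Tr_cong:
  assumes "piso \<Gamma> \<Gamma>' f" "A \<in> carrier (Bar R \<Gamma>)" "\<And>x. x \<in> pset \<Gamma> \<Longrightarrow> f x = g x"
  shows "Bar_Tr R \<Gamma> \<Gamma>' f A = Bar_Tr R \<Gamma> \<Gamma>' g A"
proof -
  have iso: "piso \<Gamma> \<Gamma>' g" using assms(1,3) by (rule piso_cong)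
  have "(f x, g x) \<in> prel \<Gamma>'" if "x \<in> pset \<Gamma>" for x
  proof -
    have "f x \<in> pset \<Gamma>'" using assms(1) that by (auto simp: piso_iff)
    then show ?thesis
      using piso_partition(2)[OF assms(1)] assms(3)[OF that]
      by (auto simp: is_partition_def equiv_def refl_on_def)
  qed
  then have "two_iso \<Gamma> \<Gamma>' f g"
    using assms(1) iso by (simp add: two_iso_def piso_pmor)
  then show ?thesis
    using assms(2) by (elim Bar_carrierE) (simp add: Bar_Tr_class assms(1) iso Tr_two_iso)
qed

lemma Bar_Tr_id:
  assumes "is_partition \<Gamma>" "A \<in> carrier (Bar R \<Gamma>)"
  shows "Bar_Tr R \<Gamma> \<Gamma> id A = A"
  using assms by (elim Bar_carrierE) (simp add: Bar_Tr_class piso_id Tr_id)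

lemma Bar_Tr_inverse:
  assumes "piso \<Gamma> \<Gamma>' f" "piso \<Gamma>' \<Gamma> g" "\<And>x. x \<in> pset \<Gamma> \<Longrightarrow> g (f x) = x" "A \<in> carrier (Bar R \<Gamma>)"
  shows "Bar_Tr R \<Gamma>' \<Gamma> g (Bar_Tr R \<Gamma> \<Gamma>' f A) = A"
proof -
  have "Bar_Tr R \<Gamma>' \<Gamma> g (Bar_Tr R \<Gamma> \<Gamma>' f A) = Bar_Tr R \<Gamma> \<Gamma> (g \<circ> f) A"
    using assms by (simp add: Bar_Tr_comp)
  also have "\<dots> = Bar_Tr R \<Gamma> \<Gamma> id A"
    using assms piso_comp[OF assms(1,2)] by (intro Bar_Tr_cong) auto
  finally show ?thesis using assms piso_partition(1)[OF assms(1)] by (simp add: Bar_Tr_id)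
qed

text \<open>\<open>PD_Res\<close> inverts \<open>Bar_Tr\<close> by means of \<open>inv_into\<close>;
  surjectivity guarantees that the chosen element is a genuine preimage.\<close>

lemma Bar_Tr_surj:
  assumes "piso \<Gamma> \<Gamma>' f"
  shows "Bar_Tr R \<Gamma> \<Gamma>' f ` carrier (Bar R \<Gamma>) = carrier (Bar R \<Gamma>')"
proof
  show "carrier (Bar R \<Gamma>') \<subseteq> Bar_Tr R \<Gamma> \<Gamma>' f ` carrier (Bar R \<Gamma>)"
  proof
    fix A assume A: "A \<in> carrier (Bar R \<Gamma>')"
    let ?g = "inv_into (pset \<Gamma>) f"
    have iso: "piso \<Gamma>' \<Gamma> ?g" using assms by (rule piso_inv_into)
    have "Bar_Tr R \<Gamma> \<Gamma>' f (Bar_Tr R \<Gamma>' \<Gamma> ?g A) = A"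
      using assms A by (intro Bar_Tr_inverse iso) (auto simp: piso_iff)
    then show "A \<in> Bar_Tr R \<Gamma> \<Gamma>' f ` carrier (Bar R \<Gamma>)"
      using Bar_Tr_closed[OF iso A] by (metis image_eqI)
  qed
qed (use assms Bar_Tr_closed in blast)

subsection \<open>External products\<close>

lemma Ext_zero_left:
  assumes "is_partition \<Lambda>" "is_partition \<Omega>" "y \<in> carrier (Val R \<Omega>)"
  shows "Ext R \<Lambda> \<Omega> \<zero>\<^bsub>Val R \<Lambda>\<^esub> y = \<zero>\<^bsub>Val R (psum \<Lambda> \<Omega>)\<^esub>"
proof -
  interpret V: abelian_group "Val R \<Lambda>" using assms(1) by (rule abelian)
  interpret S: abelian_group "Val R (psum \<Lambda> \<Omega>)" using assms by (intro abelian is_partition_psum)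
  have "Ext R \<Lambda> \<Omega> \<zero>\<^bsub>Val R \<Lambda>\<^esub> y \<in> carrier (Val R (psum \<Lambda> \<Omega>))"
    using assms by (intro Ext_closed) auto
  \<comment> \<open>Additivity applied to zero plus zero makes the product equal to its own double;
    cancellation gives zero.\<close>
  then show ?thesis
    using Ext_add_left[of \<Lambda> \<Omega> "\<zero>\<^bsub>Val R \<Lambda>\<^esub>" "\<zero>\<^bsub>Val R \<Lambda>\<^esub>" y] assms by simp
qed

lemma Ext_zero_right:
  assumes "is_partition \<Lambda>" "is_partition \<Omega>" "x \<in> carrier (Val R \<Lambda>)"
  shows "Ext R \<Lambda> \<Omega> x \<zero>\<^bsub>Val R \<Omega>\<^esub> = \<zero>\<^bsub>Val R (psum \<Lambda> \<Omega>)\<^esub>"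
proof -
  interpret V: abelian_group "Val R \<Omega>" using assms(2) by (rule abelian)
  interpret S: abelian_group "Val R (psum \<Lambda> \<Omega>)" using assms by (intro abelian is_partition_psum)
  have "Ext R \<Lambda> \<Omega> x \<zero>\<^bsub>Val R \<Omega>\<^esub> \<in> carrier (Val R (psum \<Lambda> \<Omega>))"
    using assms by (intro Ext_closed) auto
  then show ?thesis
    using Ext_add_right[of \<Lambda> \<Omega> x "\<zero>\<^bsub>Val R \<Omega>\<^esub>" "\<zero>\<^bsub>Val R \<Omega>\<^esub>"] assms by simp
qed

text \<open>Writing \<open>y\<close> as its own transfer along \<open>id\<close> turns a transfer in
  the left factor into a transfer of the product. Adding \<Omega> to both partitions keeps the
  refinement proper.\<close>

lemma Ext_Tr_ideal_left:
  assumes "a \<in> Tr_ideal R \<Lambda>" "is_partition \<Lambda>" "is_partition \<Omega>" "y \<in> carrier (Val R \<Omega>)"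
  shows "Ext R \<Lambda> \<Omega> a y \<in> Tr_ideal R (psum \<Lambda> \<Omega>)"
  using assms(1,2)
proof (induction rule: Tr_ideal_induct)
  case zero
  then show ?case using assms by (simp add: Ext_zero_left Tr_ideal_zero is_partition_psum)
next
  case (add a b)
  then show ?case using assms by (simp add: Ext_add_left Tr_ideal_add is_partition_psum)
next
  case (Tr \<Psi> c)
  have "Ext R \<Lambda> \<Omega> (Tr R \<Psi> \<Lambda> id c) y = Ext R \<Lambda> \<Omega> (Tr R \<Psi> \<Lambda> id c) (Tr R \<Omega> \<Omega> id y)"
    using assms by (simp add: Tr_id)
  also have "\<dots> = Tr R (psum \<Psi> \<Omega>) (psum \<Lambda> \<Omega>) id (Ext R \<Psi> \<Omega> c y)"
    using Ext_Tr[OF pless_pmor[OF Tr(1)] piso_pmor[OF piso_id[OF assms(3)]] Tr(2) assms(4)] by simp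
  finally show ?case
    using Tr assms by (simp add: Tr_ideal_Tr pless_psum_left Ext_closed pless_partition)
qed

lemma Ext_Tr_ideal_right:
  assumes "b \<in> Tr_ideal R \<Omega>" "is_partition \<Lambda>" "is_partition \<Omega>" "x \<in> carrier (Val R \<Lambda>)"
  shows "Ext R \<Lambda> \<Omega> x b \<in> Tr_ideal R (psum \<Lambda> \<Omega>)"
  using assms(1,3)
proof (induction rule: Tr_ideal_induct)
  case zero
  then show ?case using assms by (simp add: Ext_zero_right Tr_ideal_zero is_partition_psum)
next
  case (add a b)
  then show ?case using assms by (simp add: Ext_add_right Tr_ideal_add is_partition_psum)
next
  case (Tr \<Psi> c)
  have "Ext R \<Lambda> \<Omega> x (Tr R \<Psi> \<Omega> id c) = Ext R \<Lambda> \<Omega> (Tr R \<Lambda> \<Lambda> id x) (Tr R \<Psi> \<Omega> id c)"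
    using assms by (simp add: Tr_id)
  also have "\<dots> = Tr R (psum \<Lambda> \<Psi>) (psum \<Lambda> \<Omega>) id (Ext R \<Lambda> \<Psi> x c)"
    using Ext_Tr[OF piso_pmor[OF piso_id[OF assms(2)]] pless_pmor[OF Tr(1)] assms(4) Tr(2)] by simp
  finally show ?case
    using Tr assms by (simp add: Tr_ideal_Tr pless_psum_right Ext_closed pless_partition)
qed

text \<open>Representatives are exchanged one factor at a time; each exchange alters the product by
  an ideal element, because external products with an ideal element stay in the ideal.\<close>

lemma Bar_Ext_class:
  assumes "is_partition \<Gamma>" "is_partition \<Theta>" "a \<in> carrier (Val R \<Gamma>)" "b \<in> carrier (Val R \<Theta>)"
  shows "Bar_Ext R \<Gamma> \<Theta> (Bar_class R \<Gamma> a) (Bar_class R \<Theta> b) = Bar_class R (psum \<Gamma> \<Theta>) (Ext R \<Gamma> \<Theta> a b)"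
proof -
  interpret V: cring "Val R \<Gamma>" using assms(1) by (rule cring)
  interpret W: cring "Val R \<Theta>" using assms(2) by (rule cring)
  have "Bar_class R (psum \<Gamma> \<Theta>) (Ext R \<Gamma> \<Theta> a' b') = Bar_class R (psum \<Gamma> \<Theta>) (Ext R \<Gamma> \<Theta> a b)"
    if ab: "a' \<in> Bar_class R \<Gamma> a" "b' \<in> Bar_class R \<Theta> b" for a' b'
  proof -
    obtain i j where i: "i \<in> Tr_ideal R \<Gamma>" "a' = i \<oplus>\<^bsub>Val R \<Gamma>\<^esub> a"
      and j: "j \<in> Tr_ideal R \<Theta>" "b' = j \<oplus>\<^bsub>Val R \<Theta>\<^esub> b"
      using ab by (auto simp: mem_Bar_class)
    have c: "i \<in> carrier (Val R \<Gamma>)" "j \<in> carrier (Val R \<Theta>)"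
      using i j assms Tr_ideal_closed by blast+
    have "Bar_class R (psum \<Gamma> \<Theta>) (Ext R \<Gamma> \<Theta> a' b') = Bar_class R (psum \<Gamma> \<Theta>) (Ext R \<Gamma> \<Theta> a b')"
      unfolding i(2) using assms c i(1) j(2)
      by (simp add: Ext_add_left Bar_class_ideal_add is_partition_psum Ext_Tr_ideal_left Ext_closed)
    also have "\<dots> = Bar_class R (psum \<Gamma> \<Theta>) (Ext R \<Gamma> \<Theta> a b)"
      unfolding j(2) using assms c j(1)
      by (simp add: Ext_add_right Bar_class_ideal_add is_partition_psum Ext_Tr_ideal_right Ext_closed)
    finally show ?thesis .
  qed
  then show ?thesis
    unfolding Bar_Ext_def using Bar_class_self assms by blast
qed

lemma Bar_Ext_closed:
  assumes "is_partition \<Gamma>" "is_partition \<Theta>" "A \<in> carrier (Bar R \<Gamma>)" "B \<in> carrier (Bar R \<Theta>)"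
  shows "Bar_Ext R \<Gamma> \<Theta> A B \<in> carrier (Bar R (psum \<Gamma> \<Theta>))"
  using assms by (elim Bar_carrierE)
    (simp add: Bar_Ext_class Bar_class_closed is_partition_psum Ext_closed)

lemma Bar_Ext_Bar_Tr:
  assumes "piso \<Gamma> \<Gamma>' f" "piso \<Theta> \<Theta>' g" "A \<in> carrier (Bar R \<Gamma>)" "B \<in> carrier (Bar R \<Theta>)"
  shows "Bar_Tr R (psum \<Gamma> \<Theta>) (psum \<Gamma>' \<Theta>') (sum_map f g) (Bar_Ext R \<Gamma> \<Theta> A B) =
    Bar_Ext R \<Gamma>' \<Theta>' (Bar_Tr R \<Gamma> \<Gamma>' f A) (Bar_Tr R \<Theta> \<Theta>' g B)"
  using assms(3,4)
proof (elim Bar_carrierE)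
  fix a b
  assume "a \<in> carrier (Val R \<Gamma>)" "A = Bar_class R \<Gamma> a"
    "b \<in> carrier (Val R \<Theta>)" "B = Bar_class R \<Theta> b"
  then show ?thesis
    using assms(1,2) piso_sum_map[OF assms(1,2)] piso_partition[OF assms(1)] piso_partition[OF assms(2)]
    by (simp add: Bar_Tr_class Bar_Ext_class Ext_closed Tr_closed piso_pmor Ext_Tr)
qed

end
section \<open>The groups PD(R)\<close>

context partition_ring
begin

lemma PD_carrier_iff:
  "x \<in> carrier (PD_ring R \<Lambda>) \<longleftrightarrow> x \<in> (\<Pi>\<^sub>E \<Gamma>\<in>refinements \<Lambda>. carrier (Bar R \<Gamma>)) \<and>
    (\<forall>\<sigma>\<in>block_group \<Lambda>. PD_act R \<Lambda> \<sigma> x = x)"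
  by (simp add: PD_ring_def)

lemma PD_component_closed:
  "x \<in> carrier (PD_ring R \<Lambda>) \<Longrightarrow> ple \<Gamma> \<Lambda> \<Longrightarrow> x \<Gamma> \<in> carrier (Bar R \<Gamma>)"
  by (auto simp: PD_carrier_iff mem_refinements)

lemma PD_add_component:
  "ple \<Gamma> \<Lambda> \<Longrightarrow> (x \<oplus>\<^bsub>PD_ring R \<Lambda>\<^esub> y) \<Gamma> = x \<Gamma> \<oplus>\<^bsub>Bar R \<Gamma>\<^esub> y \<Gamma>"
  by (simp add: PD_ring_def mem_refinements)

lemma PD_zero_component: "ple \<Gamma> \<Lambda> \<Longrightarrow> \<zero>\<^bsub>PD_ring R \<Lambda>\<^esub> \<Gamma> = \<zero>\<^bsub>Bar R \<Gamma>\<^esub>"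
  by (simp add: PD_ring_def mem_refinements)

lemma PD_ext:
  assumes "x \<in> extensional (refinements \<Lambda>)" "y \<in> extensional (refinements \<Lambda>)"
    and "\<And>\<Gamma>. ple \<Gamma> \<Lambda> \<Longrightarrow> x \<Gamma> = y \<Gamma>"
  shows "x = y"
  using assms by (intro extensionalityI[of x "refinements \<Lambda>" y]) (auto simp: mem_refinements)

lemma PD_carrier_extensional: "x \<in> carrier (PD_ring R \<Lambda>) \<Longrightarrow> x \<in> extensional (refinements \<Lambda>)"
  by (auto simp: PD_carrier_iff PiE_def)

text \<open>Invariance is rephrased through isomorphisms between components, which suits the
  calculus of \<open>Bar_Tr\<close> better than \<open>PD_act\<close>. The preimage of \<Gamma>
  under \<sigma> supplies the required source.\<close>

lemma PD_carrierI:
  assumes "x \<in> extensional (refinements \<Lambda>)"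
    and "\<And>\<Gamma>. ple \<Gamma> \<Lambda> \<Longrightarrow> x \<Gamma> \<in> carrier (Bar R \<Gamma>)"
    and "\<And>\<sigma> \<Gamma> \<Gamma>'. \<lbrakk>\<sigma> \<in> block_group \<Lambda>; ple \<Gamma> \<Lambda>; ple \<Gamma>' \<Lambda>; piso \<Gamma>' \<Gamma> \<sigma>\<rbrakk> \<Longrightarrow>
      Bar_Tr R \<Gamma>' \<Gamma> \<sigma> (x \<Gamma>') = x \<Gamma>"
  shows "x \<in> carrier (PD_ring R \<Lambda>)"
proof -
  have "PD_act R \<Lambda> \<sigma> x = x" if \<sigma>: "\<sigma> \<in> block_group \<Lambda>" for \<sigma>
  proof (rule PD_ext)
    show "PD_act R \<Lambda> \<sigma> x \<in> extensional (refinements \<Lambda>)" by (simp add: PD_act_def)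
    fix \<Gamma> assume \<Gamma>: "ple \<Gamma> \<Lambda>"
    show "PD_act R \<Lambda> \<sigma> x \<Gamma> = x \<Gamma>"
      using assms(3)[OF \<sigma> \<Gamma> block_group_ptransport_inv[OF \<sigma> \<Gamma>] block_group_piso[OF \<sigma> \<Gamma>]] \<Gamma>
      by (simp add: PD_act_def mem_refinements)
  qed (fact assms(1))
  then show ?thesis
    using assms(1,2) by (auto simp: PD_carrier_iff PiE_def mem_refinements)
qed

lemma PD_invariant:
  assumes "x \<in> carrier (PD_ring R \<Lambda>)" "\<sigma> \<in> block_group \<Lambda>" "ple \<Gamma> \<Lambda>" "piso \<Gamma>' \<Gamma> \<sigma>"
  shows "Bar_Tr R \<Gamma>' \<Gamma> \<sigma> (x \<Gamma>') = x \<Gamma>"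
proof -
  have perm: "\<sigma> permutes pset \<Lambda>" using assms(2) by (simp add: block_group_def)
  \<comment> \<open>The target and the permutation leave only one possible source, namely the
    partition that occurs in \<open>PD_act\<close>.\<close>
  have "\<Gamma>' = ptransport (inv_into UNIV \<sigma>) \<Gamma>"
    using assms(4) perm by (simp add: piso_iff permutes_inv_o flip: ptransport_comp)
  moreover have "PD_act R \<Lambda> \<sigma> x \<Gamma> = x \<Gamma>"
    using assms(1,2) by (simp add: PD_carrier_iff)
  ultimately show ?thesis using assms(3) by (simp add: PD_act_def mem_refinements)
qed

text \<open>This is what makes finite sums in \<open>PD_ring R \<Lambda>\<close> computable. The
  laws hold componentwise; invariance matters for closure, where it follows from
  \<open>Bar_Tr\<close> respecting sums and zero.\<close>

lemma abelian_monoid_PD: "abelian_monoid (PD_ring R \<Lambda>)"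
proof (rule abelian_monoidI)
  have B: "abelian_monoid (Bar R \<Gamma>)" if "ple \<Gamma> \<Lambda>" for \<Gamma>
    using that cring_Bar[of \<Gamma>] by (simp add: ple_iff cring_def ring_def abelian_group_def)
  have ext: "x \<oplus>\<^bsub>PD_ring R \<Lambda>\<^esub> y \<in> extensional (refinements \<Lambda>)" for x y
    by (simp add: PD_ring_def)
  note comp = PD_component_closed[of _ \<Lambda>]
  show cl: "x \<oplus>\<^bsub>PD_ring R \<Lambda>\<^esub> y \<in> carrier (PD_ring R \<Lambda>)"
    if "x \<in> carrier (PD_ring R \<Lambda>)" "y \<in> carrier (PD_ring R \<Lambda>)" for x y
    using that comp
    by (intro PD_carrierI ext)
      (simp_all add: PD_add_component abelian_monoid.a_closed[OF B] Bar_Tr_add PD_invariant)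
  show zero: "\<zero>\<^bsub>PD_ring R \<Lambda>\<^esub> \<in> carrier (PD_ring R \<Lambda>)"
    by (intro PD_carrierI)
      (simp_all add: PD_zero_component abelian_monoid.zero_closed[OF B] Bar_Tr_zero, simp add: PD_ring_def)
  fix x y assume xy: "x \<in> carrier (PD_ring R \<Lambda>)" "y \<in> carrier (PD_ring R \<Lambda>)"
  show "\<zero>\<^bsub>PD_ring R \<Lambda>\<^esub> \<oplus>\<^bsub>PD_ring R \<Lambda>\<^esub> x = x"
    using comp xy
    by (intro PD_ext[OF ext] PD_carrier_extensional)
      (simp_all add: PD_add_component PD_zero_component abelian_monoid.l_zero[OF B])
  show "x \<oplus>\<^bsub>PD_ring R \<Lambda>\<^esub> y = y \<oplus>\<^bsub>PD_ring R \<Lambda>\<^esub> x"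
    using comp xy
    by (intro PD_ext[OF ext ext]) (simp_all add: PD_add_component abelian_monoid.a_comm[OF B])
  fix z assume z: "z \<in> carrier (PD_ring R \<Lambda>)"
  show "(x \<oplus>\<^bsub>PD_ring R \<Lambda>\<^esub> y) \<oplus>\<^bsub>PD_ring R \<Lambda>\<^esub> z = x \<oplus>\<^bsub>PD_ring R \<Lambda>\<^esub> (y \<oplus>\<^bsub>PD_ring R \<Lambda>\<^esub> z)"
    using comp xy z
    by (intro PD_ext[OF ext ext]) (simp_all add: PD_add_component abelian_monoid.a_assoc[OF B])
qed

lemma PD_finsum_component:
  assumes "finite A" "f \<in> A \<rightarrow> carrier (PD_ring R \<Lambda>)" "ple \<Gamma> \<Lambda>"
  shows "finsum (PD_ring R \<Lambda>) f A \<Gamma> = (\<Oplus>\<^bsub>Bar R \<Gamma>\<^esub>a\<in>A. f a \<Gamma>)"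
proof -
  interpret P: abelian_monoid "PD_ring R \<Lambda>" by (rule abelian_monoid_PD)
  interpret B: cring "Bar R \<Gamma>" using assms(3) cring_Bar[of \<Gamma>] by (simp add: ple_iff)
  show ?thesis
    using assms(1,2)
  proof (induction A rule: finite_induct)
    case empty
    then show ?case using assms(3) by (simp add: PD_zero_component)
  next
    case (insert a A)
    then have "f a \<in> carrier (PD_ring R \<Lambda>)" "f \<in> A \<rightarrow> carrier (PD_ring R \<Lambda>)" by auto
    moreover from this have "(\<lambda>a. f a \<Gamma>) \<in> A \<rightarrow> carrier (Bar R \<Gamma>)" "f a \<Gamma> \<in> carrier (Bar R \<Gamma>)"
      using PD_component_closed[OF _ assms(3)] by (blast intro: funcset_mem)+
    ultimately show ?case
      using insert assms(3) by (simp add: PD_add_component)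
  qed
qed

section \<open>Exponential elements\<close>

lemma sym_series_closed: "r \<in> carrier (sym_series (PD R)) \<Longrightarrow> r m \<in> carrier (PD_ring R (ul m))"
  by (simp add: sym_series_def PD_def)

text \<open>At the component \<open>psum \<Gamma> \<Theta>\<close>, the exponential condition
  equates the external product with a chosen preimage of \<open>r (i + j) \<Delta>\<close> under
  transport along \<open>juxtapose i\<close>. Applying that transport recovers the component
  itself.\<close>

lemma exponential_juxtapose:
  assumes r: "r \<in> carrier (sym_series (PD R))" and ex: "exponential (PD R) r"
    and \<Gamma>: "ple \<Gamma> (ul i)" and \<Theta>: "ple \<Theta> (ul j)"
  defines "\<Delta> \<equiv> ptransport (juxtapose i) (psum \<Gamma> \<Theta>)"
  shows "r (i + j) \<Delta> = Bar_Tr R (psum \<Gamma> \<Theta>) \<Delta> (juxtapose i) (Bar_Ext R \<Gamma> \<Theta> (r i \<Gamma>) (r j \<Theta>))"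
proof -
  have mem: "psum \<Gamma> \<Theta> \<in> refinements (psum (ul i) (ul j))"
    using \<Gamma> \<Theta> by (simp add: mem_refinements ple_psum)
  have p: "is_partition \<Gamma>" "is_partition \<Theta>" "pset \<Gamma> = {1..i}" "pset \<Theta> = {1..j}"
    using \<Gamma> \<Theta> by (auto simp: ple_ul_iff)
  then have iso: "piso (psum \<Gamma> \<Theta>) \<Delta> (juxtapose i)"
    unfolding \<Delta>_def by (intro piso_ptransport is_partition_psum) (simp_all only: pset_psum p inj_on_juxtapose)
  have "pset \<Delta> = {1..i + j}"
    unfolding \<Delta>_def by (simp only: pset_ptransport pset_psum p image_juxtapose)
  then have "ple \<Delta> (ul (i + j))"
    using piso_partition(2)[OF iso] by (simp add: ple_ul_iff)
  then have cl: "r (i + j) \<Delta> \<in> carrier (Bar R \<Delta>)"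
    using sym_series_closed[OF r] by (rule PD_component_closed[rotated])
  have "PD_Res R (psum (ul i) (ul j)) (ul (i + j)) (juxtapose i) (r (i + j)) =
      PD_Ext R (ul i) (ul j) (r i) (r j)"
    using ex by (simp add: exponential_def PD_def)
  then have "PD_Res R (psum (ul i) (ul j)) (ul (i + j)) (juxtapose i) (r (i + j)) (psum \<Gamma> \<Theta>) =
      PD_Ext R (ul i) (ul j) (r i) (r j) (psum \<Gamma> \<Theta>)" by simp
  then have "inv_into (carrier (Bar R (psum \<Gamma> \<Theta>))) (Bar_Tr R (psum \<Gamma> \<Theta>) \<Delta> (juxtapose i)) (r (i + j) \<Delta>) =
      Bar_Ext R \<Gamma> \<Theta> (r i \<Gamma>) (r j \<Theta>)"
    using mem by (simp add: PD_Res_def PD_Ext_def \<Delta>_def)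
  moreover have "Bar_Tr R (psum \<Gamma> \<Theta>) \<Delta> (juxtapose i)
      (inv_into (carrier (Bar R (psum \<Gamma> \<Theta>))) (Bar_Tr R (psum \<Gamma> \<Theta>) \<Delta> (juxtapose i)) (r (i + j) \<Delta>)) =
      r (i + j) \<Delta>"
    using cl by (intro f_inv_into_f) (simp add: Bar_Tr_surj[OF iso])
  ultimately show ?thesis by simp
qed

end

section \<open>Formal disjoint unions along lists of blocks\<close>

lemma is_partition_blocks_sum: "\<forall>B\<in>set Bs. finite B \<Longrightarrow> is_partition (blocks_sum Bs)"
  by (induction Bs) (auto intro: is_partition_psum)

lemma card_blocks_sum: "\<forall>B\<in>set Bs. finite B \<Longrightarrow> card (pset (blocks_sum Bs)) = sum_list (map card Bs)"
proof (induction Bs)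
  case (Cons B Bs)
  have "finite (pset (blocks_sum Bs))"
    using is_partition_blocks_sum[of Bs] Cons.prems by (simp add: is_partition_def)
  moreover have "card (inl ` B) = card B" "card (inr ` pset (blocks_sum Bs)) = card (pset (blocks_sum Bs))"
    by (auto intro!: card_image inj_onI)
  moreover have "inl ` B \<inter> inr ` pset (blocks_sum Bs) = {}" by auto
  ultimately show ?case
    using Cons by (simp add: card_Un_disjoint)
qed simp

text \<open>Each summand is mapped identically onto its own set, so points and relation become
  unions over the list. For a list of the blocks of \<Gamma> this recovers \<Gamma>, by
  \<open>prel_blocks\<close>.\<close>

lemma ptransport_blocks_iso:
  "ptransport (blocks_iso Bs) (blocks_sum Bs) = (\<Union>(set Bs), \<Union>B\<in>set Bs. B \<times> B)"
proof (induction Bs)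
  case Nil
  then show ?case by (simp add: ul_def indiscrete_def ptransport_def)
next
  case (Cons B Bs)
  then show ?case
    by (simp add: ptransport_copair indiscrete_def map_prod.id) (simp add: ptransport_def)
qed

text \<open>The formal disjoint union keeps its summands apart by tags; dropping the tags stays
  injective because the sets are disjoint and none is repeated.\<close>

lemma inj_on_blocks_iso:
  "distinct Bs \<Longrightarrow> pairwise disjnt (set Bs) \<Longrightarrow> inj_on (blocks_iso Bs) (pset (blocks_sum Bs))"
proof (induction Bs)
  case (Cons B Bs)
  have im: "blocks_iso Bs ` pset (blocks_sum Bs) = \<Union>(set Bs)"
    using arg_cong[OF ptransport_blocks_iso[of Bs], of pset] by simp
  have "disjnt B C" if "C \<in> set Bs" for C
    using Cons.prems that by (auto simp: pairwise_def)
  then have "B \<inter> \<Union>(set Bs) = {}" by (auto simp: disjnt_def)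
  then have ne: "b \<noteq> blocks_iso Bs x" if "b \<in> B" "x \<in> pset (blocks_sum Bs)" for b x
    using im that by blast
  have inj: "inj_on (blocks_iso Bs) (pset (blocks_sum Bs))"
    using Cons by (auto intro: pairwise_subset)
  show ?case
    using ne inj by (intro inj_onI) (auto dest: inj_onD ne[symmetric])
qed simp

lemma
  assumes "is_partition \<Gamma>"
  shows finite_blocks: "finite (blocks \<Gamma>)"
    and finite_block: "B \<in> blocks \<Gamma> \<Longrightarrow> finite B"
    and block_nonempty: "B \<in> blocks \<Gamma> \<Longrightarrow> B \<noteq> {}"
    and Union_blocks: "\<Union>(blocks \<Gamma>) = pset \<Gamma>"
    and disjoint_blocks: "pairwise disjnt (blocks \<Gamma>)"
    and prel_blocks: "prel \<Gamma> = (\<Union>B\<in>blocks \<Gamma>. B \<times> B)"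
proof -
  have eq: "equiv (pset \<Gamma>) (prel \<Gamma>)" and fin: "finite (pset \<Gamma>)"
    using assms by (auto simp: is_partition_def)
  have sub: "prel \<Gamma> \<subseteq> pset \<Gamma> \<times> pset \<Gamma>" using partition_prel_in[OF assms] by auto
  show "finite (blocks \<Gamma>)" unfolding blocks_def using fin sub by (rule finite_quotient)
  show "B \<in> blocks \<Gamma> \<Longrightarrow> finite B" unfolding blocks_def using fin sub by (rule finite_equiv_class)
  show "B \<in> blocks \<Gamma> \<Longrightarrow> B \<noteq> {}" unfolding blocks_def using eq by (rule in_quotient_imp_non_empty)
  show "\<Union>(blocks \<Gamma>) = pset \<Gamma>" unfolding blocks_def using eq by (rule Union_quotient)
  show "pairwise disjnt (blocks \<Gamma>)"
    using quotient_disj[OF eq] by (auto simp: pairwise_def disjnt_def blocks_def)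
  show "prel \<Gamma> = (\<Union>B\<in>blocks \<Gamma>. B \<times> B)"
  proof
    show "prel \<Gamma> \<subseteq> (\<Union>B\<in>blocks \<Gamma>. B \<times> B)"
    proof (rule subrelI)
      fix x y assume xy: "(x, y) \<in> prel \<Gamma>"
      then have x: "x \<in> pset \<Gamma>" using sub by auto
      then have "prel \<Gamma> `` {x} \<in> blocks \<Gamma>" "x \<in> prel \<Gamma> `` {x}" "y \<in> prel \<Gamma> `` {x}"
        using xy equiv_class_self[OF eq x] by (auto simp: blocks_def quotientI)
      then show "(x, y) \<in> (\<Union>B\<in>blocks \<Gamma>. B \<times> B)" by blast
    qed
    show "(\<Union>B\<in>blocks \<Gamma>. B \<times> B) \<subseteq> prel \<Gamma>"
      using quotient_eqI[OF eq] eq unfolding blocks_def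
      by (auto elim!: quotientE simp: equiv_def dest: symD transD)
  qed
qed

text \<open>The bijection in \<open>on_block\<close> is picked by \<open>SOME\<close>; all that
  later steps use of it is that it is some isomorphism from \<open>ul (card B)\<close>.\<close>

lemma (in partition_ring)
  assumes "finite B" "x (card B) \<in> carrier (Bar R (ul (card B)))"
  shows on_block_closed: "on_block R x B \<in> carrier (Bar R (indiscrete B))"
    and on_block_eq_Bar_Tr: "\<exists>h. piso (ul (card B)) (indiscrete B) h \<and>
      on_block R x B = Bar_Tr R (ul (card B)) (indiscrete B) h (x (card B))"
proof -
  define h where "h = (SOME h. bij_betw h {1..card B} B)"
  have "\<exists>h. bij_betw h {1..card B} B"
    using assms(1) by (intro finite_same_card_bij) auto
  then have "bij_betw h {1..card B} B" unfolding h_def by (rule someI_ex)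
  then have "piso (ul (card B)) (indiscrete B) h"
    by (auto simp: piso_iff ul_def ptransport_indiscrete bij_betw_def)
  then show "\<exists>h. piso (ul (card B)) (indiscrete B) h \<and>
      on_block R x B = Bar_Tr R (ul (card B)) (indiscrete B) h (x (card B))"
    unfolding on_block_def h_def by blast
  then show "on_block R x B \<in> carrier (Bar R (indiscrete B))"
    using assms(2) by (auto simp: Bar_Tr_closed)
qed

lemma (in partition_ring) blocks_Ext_closed:
  assumes "\<And>B. B \<in> set Bs \<Longrightarrow> finite B" "\<And>B. B \<in> set Bs \<Longrightarrow> x (card B) \<in> carrier (Bar R (ul (card B)))"
  shows "blocks_Ext R x Bs \<in> carrier (Bar R (blocks_sum Bs))"
  using assms
  by (induction Bs)
    (auto simp: Bar_class_closed Unt_closed intro!: Bar_Ext_closed is_partition_blocks_sum on_block_closed)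

text \<open>On \<open>A\<close> the permutation is \<open>g\<close> after the inverse of
  \<open>k\<close>; extending by the identity gives a permutation in the sense of
  \<open>permutes\<close>, as \<open>block_group\<close> demands.\<close>

lemma permutation_between_bijections:
  assumes k: "bij_betw k P A" and g: "bij_betw g P A"
  obtains \<sigma> where "\<sigma> permutes A" "\<And>x. x \<in> P \<Longrightarrow> \<sigma> (k x) = g x"
proof
  define \<sigma> where "\<sigma> y = (if y \<in> A then g (inv_into P k y) else y)" for y
  have "bij_betw (g \<circ> inv_into P k) A A"
    using bij_betw_inv_into[OF k] g by (rule bij_betw_trans)
  then have "bij_betw \<sigma> A A"
    by (subst bij_betw_cong[of _ _ "g \<circ> inv_into P k"]) (auto simp: \<sigma>_def)
  then show "\<sigma> permutes A" by (rule bij_imp_permutes) (simp add: \<sigma>_def)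
  show "\<sigma> (k x) = g x" if "x \<in> P" for x
    using k that by (auto simp: \<sigma>_def bij_betw_def)
qed

text \<open>The induction keeps \<open>g\<close> and \<open>m\<close> arbitrary, so that the tail of
  the list may be numbered by a bijection of its own. Nonempty sets are required because
  \<open>x\<close> is prescribed only at positive indices.\<close>

lemma (in partition_ring) exponential_blocks:
  assumes r: "r \<in> carrier (sym_series (PD R))" and ex: "exponential (PD R) r"
    and x: "\<And>i. 1 \<le> i \<Longrightarrow> x i = r i (ul i)"
    and Bs: "\<And>B. B \<in> set Bs \<Longrightarrow> finite B \<and> B \<noteq> {}"
    and g: "bij_betw g (pset (blocks_sum Bs)) {1..m}"
  shows "r m (ptransport g (blocks_sum Bs)) =
    Bar_Tr R (blocks_sum Bs) (ptransport g (blocks_sum Bs)) g (blocks_Ext R x Bs)"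
  using Bs g
proof (induction Bs arbitrary: g m)
  case Nil
  then have "card {1..m} = card ({} :: nat set)"
    using bij_betw_same_card by fastforce
  then have m: "m = 0" by simp
  have gul: "ptransport g (ul 0) = ul 0" by (simp add: ul_def ptransport_indiscrete)
  have cl: "Bar_class R (ul 0) (Unt R) \<in> carrier (Bar R (ul 0))"
    by (simp add: Bar_class_closed Unt_closed)
  \<comment> \<open>Maps out of the empty set agree vacuously, so \<open>g\<close> may be replaced
    by \<open>id\<close>.\<close>
  have "Bar_Tr R (ul 0) (ul 0) g (Bar_class R (ul 0) (Unt R)) =
      Bar_Tr R (ul 0) (ul 0) id (Bar_class R (ul 0) (Unt R))"
    using gul by (intro Bar_Tr_cong cl) (auto simp: piso_iff)
  moreover have "r 0 (ul 0) = Bar_class R (ul 0) (Unt R)"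
    using ex by (simp add: exponential_def PD_def mem_refinements ple_refl)
  ultimately show ?case by (simp add: m gul Bar_Tr_id cl)
next
  case (Cons B Bs)
  define S where "S = blocks_sum Bs"
  define b where "b = card B"
  define n where "n = card (pset S)"
  define P where "P = psum (indiscrete B) S"
  define E where "E = blocks_Ext R x Bs"
  define X where "X = on_block R x B"
  have B: "finite B" "b \<ge> 1"
    using Cons.prems(1)[of B] by (auto simp: b_def Suc_le_eq card_gt_0_iff)
  have S: "is_partition S" "finite (pset S)"
    using is_partition_blocks_sum[of Bs] Cons.prems(1) by (auto simp: S_def is_partition_def)
  have "card (pset P) = b + n"
    using card_blocks_sum[of "B # Bs"] card_blocks_sum[of Bs] Cons.prems(1)
    by (simp add: P_def S_def b_def n_def)
  then have m: "m = b + n"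
    using bij_betw_same_card[OF Cons.prems(2)] by (simp add: P_def S_def)
  have xcl: "x (card C) \<in> carrier (Bar R (ul (card C)))" if "C \<in> set (B # Bs)" for C
  proof -
    have "1 \<le> card C" using Cons.prems(1)[OF that] by (simp add: Suc_le_eq card_gt_0_iff)
    then show ?thesis
      using x PD_component_closed[OF sym_series_closed[OF r]] by (simp add: ple_refl)
  qed
  have E: "E \<in> carrier (Bar R S)"
    unfolding E_def S_def using Cons.prems(1) xcl by (intro blocks_Ext_closed) auto
  obtain h where h: "piso (ul b) (indiscrete B) h" "X = Bar_Tr R (ul b) (indiscrete B) h (x b)"
    and X: "X \<in> carrier (Bar R (indiscrete B))"
    using on_block_closed[of B x] on_block_eq_Bar_Tr[of B x] B(1) xcl[of B] unfolding b_def X_def by auto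
  \<comment> \<open>Undoing the chosen numbering of \<open>B\<close> leads from
    \<open>on_block\<close> back to the top component of \<open>r b\<close>, the left factor that
    exponentiality produces.\<close>
  define h' where "h' = inv_into {1..b} h"
  have h': "piso (indiscrete B) (ul b) h'"
    using piso_inv_into[OF h(1)] by (simp only: pset_ul h'_def)
  have xb: "r b (ul b) = Bar_Tr R (indiscrete B) (ul b) h' X"
  proof -
    have "inj_on h {1..b}" using h(1) by (simp add: piso_iff)
    then have inv: "h' (h y) = y" if "y \<in> pset (ul b)" for y
      using that unfolding h'_def pset_ul by (rule inv_into_f_f)
    have "x b \<in> carrier (Bar R (ul b))" using xcl[of B] by (simp add: b_def)
    then show ?thesis
      unfolding h(2) x[OF B(2), symmetric] by (intro Bar_Tr_inverse[symmetric] h(1) h' inv)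
  qed
  \<comment> \<open>Any numbering of the tail will do, since the induction hypothesis covers all of
    them.\<close>
  have "\<exists>g'. bij_betw g' (pset S) {1..n}"
    by (rule finite_same_card_bij) (simp_all add: n_def S(2))
  then obtain g' where g': "bij_betw g' (pset S) {1..n}" ..
  define \<Theta> where "\<Theta> = ptransport g' S"
  have iso_g': "piso S \<Theta> g'"
    unfolding \<Theta>_def using S(1) g' by (intro piso_ptransport) (auto simp: bij_betw_def)
  have \<Theta>: "ple \<Theta> (ul n)"
    using piso_partition(2)[OF iso_g'] g' by (simp add: ple_ul_iff \<Theta>_def bij_betw_def)
  have IH: "r n \<Theta> = Bar_Tr R S \<Theta> g' E"
    unfolding \<Theta>_def S_def E_def
    using Cons.prems(1) g' by (intro Cons.IH) (auto simp: S_def)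
  define \<Delta> where "\<Delta> = ptransport (juxtapose b) (psum (ul b) \<Theta>)"
  have p\<Theta>: "pset \<Theta> = {1..n}" "is_partition \<Theta>" using \<Theta> by (simp_all only: ple_ul_iff)
  have iso1: "piso P (psum (ul b) \<Theta>) (sum_map h' g')"
    unfolding P_def using h' iso_g' by (rule piso_sum_map)
  have iso2: "piso (psum (ul b) \<Theta>) \<Delta> (juxtapose b)"
    unfolding \<Delta>_def
    by (intro piso_ptransport is_partition_psum is_partition_ul p\<Theta>(2))
      (simp only: pset_psum pset_ul p\<Theta> inj_on_juxtapose)
  have p\<Delta>: "pset \<Delta> = {1..m}"
    unfolding \<Delta>_def m by (simp only: pset_ptransport pset_psum pset_ul p\<Theta> image_juxtapose)
  \<comment> \<open>Under \<open>k\<close> the head occupies \<open>{1..b}\<close> and the tail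
    \<open>{b+1..m}\<close>, the arrangement to which \<open>exponential_juxtapose\<close>
    applies.\<close>
  define k where "k = juxtapose b \<circ> sum_map h' g'"
  have iso_k: "piso P \<Delta> k" unfolding k_def using iso1 iso2 by (rule piso_comp)
  then have "bij_betw k (pset P) {1..m}"
    using p\<Delta> by (auto simp: piso_iff bij_betw_def)
  \<comment> \<open>The given numbering \<open>g\<close> differs from \<open>k\<close> by a
    permutation of \<open>{1..m}\<close>, and \<open>r m\<close> is invariant under it.\<close>
  then obtain \<sigma> where \<sigma>: "\<sigma> permutes {1..m}" "\<And>x. x \<in> pset P \<Longrightarrow> \<sigma> (k x) = g x"
    using Cons.prems(2) unfolding P_def S_def blocks_sum.simps
    by (rule permutation_between_bijections) blast
  define \<Gamma> where "\<Gamma> = ptransport g P"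
  have iso_g: "piso P \<Gamma> g"
    unfolding \<Gamma>_def using Cons.prems(2) S(1) B(1)
    by (intro piso_ptransport) (auto simp: P_def S_def bij_betw_def intro!: is_partition_psum)
  have "\<Gamma> = ptransport \<sigma> \<Delta>"
    using iso_k iso_g \<sigma>(2) ptransport_cong[of P "\<sigma> \<circ> k" g]
    by (simp add: piso_iff ptransport_comp)
  then have iso_\<sigma>: "piso \<Delta> \<Gamma> \<sigma>"
    using piso_partition(2)[OF iso_k] \<sigma>(1) by (simp add: piso_iff permutes_inj_on)
  have \<Gamma>: "ple \<Gamma> (ul m)"
    using piso_partition(2)[OF iso_g] Cons.prems(2)
    by (simp add: ple_ul_iff \<Gamma>_def P_def S_def bij_betw_def)
  let ?Y = "Bar_Ext R (indiscrete B) S X E"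
  have Y: "?Y \<in> carrier (Bar R P)"
    unfolding P_def using X E S B(1) by (intro Bar_Ext_closed) auto
  have "r m \<Gamma> = Bar_Tr R \<Delta> \<Gamma> \<sigma> (r m \<Delta>)"
    using PD_invariant[OF sym_series_closed[OF r] _ \<Gamma> iso_\<sigma>] \<sigma>(1) by (simp add: block_group_ul)
  also have "r m \<Delta> =
      Bar_Tr R (psum (ul b) \<Theta>) \<Delta> (juxtapose b) (Bar_Ext R (ul b) \<Theta> (r b (ul b)) (r n \<Theta>))"
    unfolding \<Delta>_def m using r ex \<Theta> by (intro exponential_juxtapose ple_refl is_partition_ul)
  also have "Bar_Ext R (ul b) \<Theta> (r b (ul b)) (r n \<Theta>) =
      Bar_Tr R P (psum (ul b) \<Theta>) (sum_map h' g') ?Y"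
    unfolding xb IH P_def using h' iso_g' X E by (intro Bar_Ext_Bar_Tr[symmetric])
  also have "Bar_Tr R (psum (ul b) \<Theta>) \<Delta> (juxtapose b) \<dots> = Bar_Tr R P \<Delta> k ?Y"
    unfolding k_def using iso1 iso2 Y by (rule Bar_Tr_comp)
  also have "Bar_Tr R \<Delta> \<Gamma> \<sigma> \<dots> = Bar_Tr R P \<Gamma> (\<sigma> \<circ> k) ?Y"
    using iso_k iso_\<sigma> Y by (rule Bar_Tr_comp)
  also have "\<dots> = Bar_Tr R P \<Gamma> g ?Y"
    using piso_comp[OF iso_k iso_\<sigma>] Y \<sigma>(2) by (intro Bar_Tr_cong) auto
  finally show ?case by (simp add: \<Gamma>_def P_def S_def X_def E_def)
qed

text \<open>The list selected by \<open>SOME\<close> enumerates the blocks of \<Gamma>, so the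
  version for lists applies to it with \<open>blocks_iso\<close> as the bijection.\<close>

lemma (in partition_ring) exponential_block_product:
  assumes r: "r \<in> carrier (sym_series (PD R))" and ex: "exponential (PD R) r"
    and x: "\<And>i. 1 \<le> i \<Longrightarrow> x i = r i (ul i)" and \<Gamma>: "ple \<Gamma> (ul m)"
  shows "r m \<Gamma> = block_product R x \<Gamma>"
proof -
  have p: "is_partition \<Gamma>" "pset \<Gamma> = {1..m}" using \<Gamma> by (auto simp: ple_ul_iff)
  define Bs where "Bs = (SOME Bs. distinct Bs \<and> set Bs = blocks \<Gamma>)"
  have "\<exists>Bs. distinct Bs \<and> set Bs = blocks \<Gamma>"
    using finite_distinct_list[OF finite_blocks[OF p(1)]] by auto
  then have Bs: "distinct Bs" "set Bs = blocks \<Gamma>"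
    unfolding Bs_def by (rule someI2_ex, simp)+
  have tr: "ptransport (blocks_iso Bs) (blocks_sum Bs) = \<Gamma>"
    by (simp only: ptransport_blocks_iso Bs(2) Union_blocks[OF p(1)] flip: prel_blocks[OF p(1)]) simp
  have "inj_on (blocks_iso Bs) (pset (blocks_sum Bs))"
    using Bs disjoint_blocks[OF p(1)] by (intro inj_on_blocks_iso) auto
  moreover have "blocks_iso Bs ` pset (blocks_sum Bs) = {1..m}"
    using arg_cong[OF tr, of pset] p(2) by simp
  ultimately have "bij_betw (blocks_iso Bs) (pset (blocks_sum Bs)) {1..m}"
    by (simp add: bij_betw_def)
  then have "r m (ptransport (blocks_iso Bs) (blocks_sum Bs)) =
      Bar_Tr R (blocks_sum Bs) (ptransport (blocks_iso Bs) (blocks_sum Bs)) (blocks_iso Bs)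
        (blocks_Ext R x Bs)"
    using Bs(2) finite_block[OF p(1)] block_nonempty[OF p(1)]
    by (intro exponential_blocks r ex x) auto
  then show ?thesis
    unfolding tr by (simp add: block_product_def Bs_def[symmetric])
qed

section \<open>Block types\<close>

text \<open>\<open>has_type\<close> leaves index 0 free while \<open>exponents\<close> demands 0
  there. Fixing that value makes this the unique sequence in the index set that can be the type of
  \<Gamma>.\<close>

definition block_type :: "part \<Rightarrow> nat \<Rightarrow> nat" where
  "block_type \<Gamma> i = (if i = 0 then 0 else card {B \<in> blocks \<Gamma>. card B = i})"

lemma has_type_iff: "l 0 = 0 \<Longrightarrow> has_type \<Gamma> l \<longleftrightarrow> l = block_type \<Gamma>"
  by (auto simp: has_type_def block_type_def fun_eq_iff Suc_le_eq)

text \<open>The points are counted block by block, and the blocks are then grouped by size.\<close>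

lemma block_type_exponents:
  assumes "is_partition \<Gamma>"
  shows "block_type \<Gamma> \<in> exponents (card (pset \<Gamma>))"
proof -
  let ?l = "block_type \<Gamma>"
  have fin: "finite (blocks \<Gamma>)" using assms by (rule finite_blocks)
  have pos: "card B \<noteq> 0" if "B \<in> blocks \<Gamma>" for B
    using finite_block[OF assms that] block_nonempty[OF assms that] by simp
  \<comment> \<open>No block is empty, so the guard at index 0 removes nothing and the support
    consists of the block sizes that occur.\<close>
  have supp: "{i. ?l i \<noteq> 0} = card ` blocks \<Gamma>"
  proof (intro equalityI subsetI)
    fix i assume "i \<in> {i. ?l i \<noteq> 0}"
    then have "{B \<in> blocks \<Gamma>. card B = i} \<noteq> {}"
      unfolding block_type_def mem_Collect_eq by (metis card.empty)
    then show "i \<in> card ` blocks \<Gamma>" by blast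
  next
    fix i assume "i \<in> card ` blocks \<Gamma>"
    then obtain B where "B \<in> blocks \<Gamma>" "i = card B" by blast
    then show "i \<in> {i. ?l i \<noteq> 0}"
      using fin pos[of B] by (auto simp: block_type_def card_gt_0_iff)
  qed
  have "card (pset \<Gamma>) = (\<Sum>B\<in>blocks \<Gamma>. card B)"
    using card_Union_disjoint[OF disjoint_blocks[OF assms] finite_block[OF assms]]
    by (simp add: Union_blocks[OF assms])
  also have "\<dots> = (\<Sum>i\<in>card ` blocks \<Gamma>. \<Sum>B | B \<in> blocks \<Gamma> \<and> card B = i. card B)"
    using fin by (rule sum.image_gen)
  also have "\<dots> = (\<Sum>i\<in>card ` blocks \<Gamma>. i * ?l i)"
  proof (rule sum.cong)
    fix i assume "i \<in> card ` blocks \<Gamma>"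
    then have "i \<noteq> 0" using pos by blast
    moreover have "(\<Sum>B | B \<in> blocks \<Gamma> \<and> card B = i. card B) = (\<Sum>B | B \<in> blocks \<Gamma> \<and> card B = i. i)"
      by (rule sum.cong) simp_all
    ultimately show "(\<Sum>B | B \<in> blocks \<Gamma> \<and> card B = i. card B) = i * ?l i"
      by (simp add: block_type_def)
  qed simp
  finally have "(\<Sum>i\<in>card ` blocks \<Gamma>. i * ?l i) = card (pset \<Gamma>)" ..
  moreover have "?l 0 = 0" by (simp add: block_type_def)
  ultimately show ?thesis
    using fin unfolding exponents_def mem_Collect_eq supp by blast
qed

text \<open>At a nonzero entry both \<open>i\<close> and \<open>l i\<close> are positive, so each is
  at most \<open>i * l i\<close>, a summand of \<open>m\<close>. Finiteness keeps the
  \<open>finsum\<close> in \<open>integral_exp\<close> from being a default value.\<close>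

lemma finite_exponents: "finite (exponents m)"
proof (rule finite_subset)
  show "finite {l. \<forall>i. (i \<in> {..m} \<longrightarrow> l i \<in> {..m}) \<and> (i \<notin> {..m} \<longrightarrow> l i = (0::nat))}"
    by (rule finite_set_of_finite_funs) simp_all
  have le_m: "i * l i \<le> m" if "l \<in> exponents m" "l i \<noteq> 0" for l i
    using that member_le_sum[of i "{i. l i \<noteq> 0}" "\<lambda>i. i * l i"] by (auto simp: exponents_def)
  have pos: "0 < i" "0 < l i" if "l \<in> exponents m" "l i \<noteq> 0" for l i
    using that by (auto simp: exponents_def intro: gr0I)
  have bound: "i \<le> m" "l i \<le> m" if "l \<in> exponents m" "l i \<noteq> 0" for l i
  proof -
    have "i \<le> i * l i" "l i \<le> i * l i" using pos[OF that] by simp_all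
    with le_m[OF that] show "i \<le> m" "l i \<le> m" by linarith+
  qed
  show "exponents m \<subseteq> {l. \<forall>i. (i \<in> {..m} \<longrightarrow> l i \<in> {..m}) \<and> (i \<notin> {..m} \<longrightarrow> l i = 0)}"
  proof (intro subsetI CollectI allI conjI impI)
    fix l i assume l: "l \<in> exponents m"
    show "l i \<in> {..m}" using bound(2)[OF l, of i] by (cases "l i = 0") auto
    show "l i = 0" if "i \<notin> {..m}" using bound(1)[OF l, of i] that by auto
  qed
qed

text \<open>An isomorphism maps blocks bijectively to blocks of the same size. Hence the support of
  a divided monomial is stable under permutations, which its membership in the invariants
  requires.\<close>

lemma block_type_piso:
  assumes "piso \<Gamma> \<Gamma>' f"
  shows "block_type \<Gamma>' = block_type \<Gamma>"
proof
  fix i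
  have p: "is_partition \<Gamma>" and inj: "inj_on f (pset \<Gamma>)" and \<Gamma>': "\<Gamma>' = ptransport f \<Gamma>"
    using assms by (auto simp: piso_iff)
  have im: "prel \<Gamma>' `` {f x} = f ` (prel \<Gamma> `` {x})" if x: "x \<in> pset \<Gamma>" for x
  proof
    show "prel \<Gamma>' `` {f x} \<subseteq> f ` (prel \<Gamma> `` {x})"
    proof
      fix y assume "y \<in> prel \<Gamma>' `` {f x}"
      then obtain a c where ac: "(a, c) \<in> prel \<Gamma>" "f x = f a" "y = f c"
        by (auto simp: \<Gamma>' prel_ptransport)
      then have "a = x" using x inj partition_prel_in[OF p ac(1)] by (auto dest: inj_onD)
      then show "y \<in> f ` (prel \<Gamma> `` {x})" using ac by auto
    qed
  qed (force simp: \<Gamma>' prel_ptransport)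
  have bl: "blocks \<Gamma>' = (`) f ` blocks \<Gamma>"
  proof -
    have "blocks \<Gamma>' = (\<lambda>x. prel \<Gamma>' `` {f x}) ` pset \<Gamma>"
      by (auto simp: blocks_def quotient_def \<Gamma>')
    also have "\<dots> = (\<lambda>x. f ` (prel \<Gamma> `` {x})) ` pset \<Gamma>" by (intro image_cong im) auto
    also have "\<dots> = (`) f ` blocks \<Gamma>" by (auto simp: blocks_def quotient_def)
    finally show ?thesis .
  qed
  have sub: "B \<subseteq> pset \<Gamma>" if "B \<in> blocks \<Gamma>" for B using that Union_blocks[OF p] by auto
  have "card (f ` B) = card B" if "B \<in> blocks \<Gamma>" for B
    using inj_on_subset[OF inj sub[OF that]] by (rule card_image)
  then have "{B \<in> blocks \<Gamma>'. card B = i} = (`) f ` {B \<in> blocks \<Gamma>. card B = i}"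
    unfolding bl by auto
  moreover have "inj_on ((`) f) {B \<in> blocks \<Gamma>. card B = i}"
    by (rule inj_onI) (simp add: inj_on_image_eq_iff[OF inj sub sub])
  ultimately show "block_type \<Gamma>' i = block_type \<Gamma> i"
    by (simp add: block_type_def card_image)
qed

section \<open>Comparison with the integral exponential\<close>

theorem theorem10p3:
  fixes R :: "'r monoidal_pfunctor"
    and r :: "nat \<Rightarrow> part \<Rightarrow> 'r set"
  assumes "partition_ring R"
    and "r \<in> carrier (sym_series (PD R))"
    and "exponential (PD R) r"
  shows "r = integral_exp R (\<lambda>i. if i = 0 then \<zero>\<^bsub>Val (PD R) (ul 0)\<^esub>
                                 else r i \<otimes>\<^bsub>Val (PD R) (ul i)\<^esub> top_one R i)"
proof
  fix m
  interpret partition_ring R by fact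
  interpret P: abelian_monoid "PD_ring R (ul m)" by (rule abelian_monoid_PD)
  note r = assms(2) and ex = assms(3)
  define x where "x = (\<lambda>i. if i = 0 then \<zero>\<^bsub>Val (PD R) (ul 0)\<^esub>
                            else r i \<otimes>\<^bsub>Val (PD R) (ul i)\<^esub> top_one R i)"
  \<comment> \<open>At the component \<open>ul i\<close>, multiplying by \<open>top_one R i\<close>
    is multiplying by one. Index 0 is left out because \<open>x\<close> is zero there, while
    \<open>r 0\<close> is the unit.\<close>
  have x: "x i (ul i) = r i (ul i)" if "1 \<le> i" for i
  proof -
    interpret B: cring "Bar R (ul i)" by (simp add: cring_Bar)
    have "ul i \<in> refinements (ul i)" by (simp add: mem_refinements ple_refl)
    moreover have "r i (ul i) \<in> carrier (Bar R (ul i))"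
      using PD_component_closed[OF sym_series_closed[OF r]] by (simp add: ple_refl)
    ultimately show ?thesis
      using that by (simp add: x_def PD_def PD_ring_def top_one_def)
  qed
  have prod: "block_product R (\<lambda>i. x i (ul i)) \<Gamma> = r m \<Gamma>" if "ple \<Gamma> (ul m)" for \<Gamma>
    using exponential_block_product[OF r ex x that] by simp
  have rm: "r m \<in> carrier (PD_ring R (ul m))" using r by (rule sym_series_closed)
  have B: "cring (Bar R \<Gamma>)" if "ple \<Gamma> (ul m)" for \<Gamma>
    using that by (intro cring_Bar) (simp add: ple_iff)
  \<comment> \<open>The divided monomials cut \<open>r m\<close> into pieces according to block
    type.\<close>
  have dm: "divided_monomial R x m l \<Gamma> = (if block_type \<Gamma> = l then r m \<Gamma> else \<zero>\<^bsub>Bar R \<Gamma>\<^esub>)"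
    if "l \<in> exponents m" "ple \<Gamma> (ul m)" for l \<Gamma>
    using that has_type_iff[of l \<Gamma>] prod
    by (auto simp: divided_monomial_def mem_refinements exponents_def)
  \<comment> \<open>The sum can be read off at a component only once its terms are known to be
    invariant families.\<close>
  have dm_closed: "divided_monomial R x m l \<in> carrier (PD_ring R (ul m))" if l: "l \<in> exponents m" for l
  proof (rule PD_carrierI)
    show "divided_monomial R x m l \<in> extensional (refinements (ul m))"
      by (simp add: divided_monomial_def)
    show "divided_monomial R x m l \<Gamma> \<in> carrier (Bar R \<Gamma>)" if "ple \<Gamma> (ul m)" for \<Gamma>
      using dm[OF l that] PD_component_closed[OF rm that] cring.cring_simprules(2)[OF B[OF that]]
      by simp
    show "Bar_Tr R \<Gamma>' \<Gamma> \<sigma> (divided_monomial R x m l \<Gamma>') = divided_monomial R x m l \<Gamma>"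
      if "\<sigma> \<in> block_group (ul m)" "ple \<Gamma> (ul m)" "ple \<Gamma>' (ul m)" "piso \<Gamma>' \<Gamma> \<sigma>" for \<sigma> \<Gamma> \<Gamma>'
      using dm[OF l that(2)] dm[OF l that(3)] block_type_piso[OF that(4)]
        PD_invariant[OF rm that(1,2,4)] Bar_Tr_zero[OF that(4)]
      by simp
  qed
  have "r m = (\<Oplus>\<^bsub>PD_ring R (ul m)\<^esub>l\<in>exponents m. divided_monomial R x m l)"
  proof (rule PD_ext)
    show "r m \<in> extensional (refinements (ul m))" using rm by (rule PD_carrier_extensional)
    show "(\<Oplus>\<^bsub>PD_ring R (ul m)\<^esub>l\<in>exponents m. divided_monomial R x m l) \<in> extensional (refinements (ul m))"
      using dm_closed by (intro PD_carrier_extensional P.finsum_closed) auto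
    fix \<Gamma> assume \<Gamma>: "ple \<Gamma> (ul m)"
    interpret B: cring "Bar R \<Gamma>" using \<Gamma> by (rule B)
    have cl: "r m \<Gamma> \<in> carrier (Bar R \<Gamma>)" using rm \<Gamma> by (rule PD_component_closed)
    have "block_type \<Gamma> \<in> exponents m"
      using \<Gamma> block_type_exponents[of \<Gamma>] by (simp add: ple_ul_iff)
    \<comment> \<open>The value at \<Gamma> is written as a sum supported at the single index
      \<open>block_type \<Gamma>\<close>, to match the divided monomials term by term.\<close>
    then have "r m \<Gamma> =
        (\<Oplus>\<^bsub>Bar R \<Gamma>\<^esub>l\<in>exponents m. if block_type \<Gamma> = l then r m \<Gamma> else \<zero>\<^bsub>Bar R \<Gamma>\<^esub>)"
      using cl finite_exponents
      by (subst B.add.finprod_singleton[where f = "\<lambda>_. r m \<Gamma>"]) auto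
    also have "\<dots> = (\<Oplus>\<^bsub>Bar R \<Gamma>\<^esub>l\<in>exponents m. divided_monomial R x m l \<Gamma>)"
      using cl dm[OF _ \<Gamma>] by (intro B.finsum_cong') auto
    also have "\<dots> = (\<Oplus>\<^bsub>PD_ring R (ul m)\<^esub>l\<in>exponents m. divided_monomial R x m l) \<Gamma>"
      using dm_closed finite_exponents \<Gamma> by (intro PD_finsum_component[symmetric]) auto
    finally show "r m \<Gamma> = (\<Oplus>\<^bsub>PD_ring R (ul m)\<^esub>l\<in>exponents m. divided_monomial R x m l) \<Gamma>" .
  qed
  then show "r m = integral_exp R (\<lambda>i. if i = 0 then \<zero>\<^bsub>Val (PD R) (ul 0)\<^esub>
                                 else r i \<otimes>\<^bsub>Val (PD R) (ul i)\<^esub> top_one R i) m"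
    unfolding x_def[symmetric] integral_exp_def by (simp add: PD_def)
qed

end
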